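(* Let $u\in V$ be a quasiprimary vector of weight $N\ge1$, let $v_{\alpha_k}\in\mathcal W_{\alpha_k}$ be inserted at $y_k$ for $k=1,\ldots,n$ with intermediate module labels $\boldsymbol\beta=\beta_1,\ldots,\beta_{n-1}$, and let $\pi_N(x,y)=\frac1{x-y}+\sum_{\ell=0}^{2N-2}f_\ell(x)y^\ell$ for any formal Laurent series $f_\ell(x)$. Then: (1) for every polynomial $p$ with complex coefficients of degree at most $2N-2$, $$\sum_{k=1}^n\sum_{j\ge0}Z^{(0)}(\ldots;u(j)v_{\alpha_k},y_k;\ldots|\boldsymbol\alpha;\boldsymbol\beta)\,p^{(j)}(y_k)=0;$$ (2) $$Z^{(0)}(u,x;\boldsymbol{v_\alpha},\boldsymbol y|0,\boldsymbol\alpha;0,\boldsymbol\beta)=\sum_{k=1}^n\sum_{j\ge0}\pi_N^{(0,j)}(x,y_k)Z^{(0)}(\ldots;u(j)v_{\alpha_k},y_k;\ldots|\boldsymbol\alpha;\boldsymbol\beta);$$ (3) for all $i\ge0$, $$Z^{(0)}(u(-i-1)v_{\alpha_1},y_1;\ldots|\boldsymbol\alpha;\boldsymbol\beta)=\sum_{j\ge0}e_i^j(y_1)Z^{(0)}(u(j)v_{\alpha_1},y_1;\ldots|\boldsymbol\alpha;\boldsymbol\beta)+\sum_{k=2}^n\sum_{j\ge0}\pi_N^{(i,j)}(y_1,y_k)Z^{(0)}(\ldots;u(j)v_{\alpha_k},y_k;\ldots|\boldsymbol\alpha;\boldsymbol\beta),$$ where $e_i^j(y)=\sum_{\ell=0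}^{2N-2}f_\ell^{(i)}(y)\,\frac1{j!}\partial_y^jy^\ell$.
   Context: $V=(V,Y,\mathbf 1,\omega)$ is a simple vertex operator algebra over $\mathbb C$ of strong CFT type ($V=\bigoplus_{n\ge0}V_n$, $\dim V_n<\infty$, $V_0=\mathbb C\mathbf 1$, $L(1)V_1=0$), isomorphic to its contragredient module; $Y(u,z)=\sum_nu(n)z^{-n-1}$, $Y(\omega,z)=\sum_nL(n)z^{-n-2}$; $u$ is quasiprimary of weight $N$ if $u\in V_N$, $L(1)u=0$. $\langle\cdot,\cdot\rangle$ is the unique non-degenerate invariant bilinear form on $V$ with $\langle\mathbf 1,\mathbf 1\rangle=1$. $\{(Y_\alpha,\mathcal W_\alpha)\}_{\alpha\in\mathcal A}$ are the inequivalent irreducible ordinary $V$-modules, $\mathcal W_0=V$, $\mathcal W_\alpha=\bigoplus_{n\ge0}\mathcal W_{\alpha,n+h_\alpha}$ with finite-dimensional $L(0)$-eigenspaces of weight $n+h_\alpha$, $h_\alpha\in\mathbb C$; $\alpha'$ labels the contragredient of $\mathcal W_\alpha$; the modes of $u$ on modules are also written $u(n)$. $\mathcal Y^\gamma_{\alpha\beta}$ denotes a fixed intertwining operator of type $\binom{\gamma}{\alpha\ \beta}$ (Frenkel–Huang–Lepowsky), with $\mathcal Y^\beta_{0\beta}=Y_\beta$. The dimensions $N^\gamma_{\alpha\beta}$ of spaces of intertwining operators are assumed to satisfy $N^\gamma_{\alpha0}=\delta_{\alpha\gamma}$, $N^0_{\alpha\beta}=\delta_{\alpha\beta'}$. For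 intermediate labels with $\beta_1=\alpha_1'$, $\beta_{n-1}=\alpha_n$, $$Z^{(0)}(\boldsymbol{v_\alpha},\boldsymbol y|\boldsymbol\alpha;\boldsymbol\beta)=\langle\mathbf 1,\mathcal Y^0_{\alpha_1\beta_1}(v_{\alpha_1},y_1)\cdots\mathcal Y^{\beta_{k-1}}_{\alpha_k\beta_k}(v_{\alpha_k},y_k)\cdots\mathcal Y^{\beta_{n-1}}_{\alpha_n0}(v_{\alpha_n},y_n)\mathbf 1\rangle,$$ and $Z^{(0)}(u,x;\boldsymbol{v_\alpha},\boldsymbol y|0,\boldsymbol\alpha;0,\boldsymbol\beta)$ is the same with $Y(u,x)$ inserted immediately to the left of $\mathcal Y^0_{\alpha_1\beta_1}(v_{\alpha_1},y_1)$. These are formal series; $(x-y)^{-1}$ is expanded in non-negative powers of the second variable $y$. $f^{(i)}=\frac1{i!}\partial^if$, $\pi_N^{(i,j)}(x,y)=\frac1{i!j!}\partial_x^i\partial_y^j\pi_N(x,y)$. *)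

theory Defs
  imports
    Complex_Main
    "HOL-Library.Groups_Big_Fun"
    "HOL-Library.Function_Algebras"
    "HOL-Computational_Algebra.Formal_Laurent_Series"
    "HOL-Computational_Algebra.Polynomial_FPS"
begin

section \<open>Complex vector spaces\<close>

class complex_vector = ab_group_add +
  fixes scaleC :: "complex \<Rightarrow> 'a \<Rightarrow> 'a"  (infixr "*\<^sub>C" 75)
  assumes scaleC_add_right: "a *\<^sub>C (x + y) = a *\<^sub>C x + a *\<^sub>C y"
    and scaleC_add_left: "(a + b) *\<^sub>C x = a *\<^sub>C x + b *\<^sub>C x"
    and scaleC_scaleC: "a *\<^sub>C b *\<^sub>C x = (a * b) *\<^sub>C x"
    and scaleC_one: "1 *\<^sub>C x = x"

global_interpretation cvec: vector_space "scaleC :: complex \<Rightarrow> 'a \<Rightarrow> 'a::complex_vector"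
  by unfold_locales (simp_all add: scaleC_add_right scaleC_add_left scaleC_scaleC scaleC_one)

instantiation complex :: complex_vector
begin

definition scaleC_complex_def: "c *\<^sub>C (x::complex) = c * x"

instance
  by standard (simp_all add: scaleC_complex_def algebra_simps)

end

instantiation "fun" :: (type, complex_vector) complex_vector
begin

definition scaleC_fun_def: "c *\<^sub>C f = (\<lambda>x. c *\<^sub>C f x)"

instance
  by standard (simp_all add: scaleC_fun_def fun_eq_iff scaleC_add_right scaleC_add_left
      scaleC_scaleC scaleC_one)

end

text \<open>\<open>cvec.dim\<close> is \<open>0\<close> for infinite-dimensional spaces, hence the explicit finite basis.\<close>

definition has_dim :: "'a::complex_vector set \<Rightarrow> nat \<Rightarrow> bool" where
  "has_dim S d \<longleftrightarrow>
     (\<exists>B. finite B \<and> card B = d \<and> cvec.independent B \<and> cvec.span B = S)"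

definition clinear_on :: "'a::complex_vector set \<Rightarrow> ('a \<Rightarrow> 'b::complex_vector) \<Rightarrow> bool" where
  "clinear_on S f \<longleftrightarrow>
     (\<forall>x\<in>S. \<forall>y\<in>S. f (x + y) = f x + f y) \<and> (\<forall>c. \<forall>x\<in>S. f (c *\<^sub>C x) = c *\<^sub>C f x)"

definition cbilinear_on ::
  "'a::complex_vector set \<Rightarrow> 'b::complex_vector set \<Rightarrow> ('a \<Rightarrow> 'b \<Rightarrow> 'c::complex_vector) \<Rightarrow> bool" where
  "cbilinear_on A B f \<longleftrightarrow>
     (\<forall>a\<in>A. clinear_on B (f a)) \<and> (\<forall>b\<in>B. clinear_on A (\<lambda>a. f a b))"


section \<open>Vertex operator algebras and their modules\<close>

text \<open>
  A vertex operator algebra and all its modules are subspaces of one ambient complex vector space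
  \<open>'a\<close>; operators are only constrained on these subspaces. \<open>mode M u n w\<close> is \<open>u(n)w\<close>, where
  \<open>Y(u,z) = \<Sum> u(n) z\<^bsup>-n-1\<^esup>\<close>.
  All sums written with \<^const>\<open>Sum_any\<close> below have finite support (for the algebraic identities,
  by the truncation axioms).
\<close>

record 'a vmodule =
  carr :: "'a set"
  mode :: "'a \<Rightarrow> int \<Rightarrow> 'a \<Rightarrow> 'a"

record 'a voa = "'a vmodule" +
  vac :: 'a
  conf :: 'a

definition adjoint :: "'a voa \<Rightarrow> 'a vmodule" where
  "adjoint V = \<lparr>carr = carr V, mode = mode V\<rparr>"

definition Lop :: "'a voa \<Rightarrow> 'a vmodule \<Rightarrow> int \<Rightarrow> 'a \<Rightarrow> 'a" where
  "Lop V M n w = mode M (conf V) (n + 1) w"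

definition wt_space :: "'a::complex_vector voa \<Rightarrow> 'a vmodule \<Rightarrow> complex \<Rightarrow> 'a set" where
  "wt_space V M \<mu> = {w \<in> carr M. Lop V M 0 w = \<mu> *\<^sub>C w}"

text \<open>
  \<open>I w k w'\<close> is the coefficient of \<open>z\<^bsup>-k-1\<^esup>\<close> in \<open>\<Y>(w,z)w'\<close>. The index type \<open>'k\<close> is \<^typ>\<open>int\<close> for
  module actions and \<^typ>\<open>complex\<close> for intertwining operators. \<open>jacobi\<close> is the coefficient of
  \<open>z\<^sub>0\<^bsup>-l-1\<^esup> z\<^sub>1\<^bsup>-m-1\<^esup> z\<^sub>2\<^bsup>-k-1\<^esup>\<close> in
  \<open>z\<^sub>2\<^bsup>-1\<^esup>\<delta>((z\<^sub>1-z\<^sub>0)/z\<^sub>2) \<Y>(Y(u,z\<^sub>0)w\<^sub>1,z\<^sub>2)w\<^sub>2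
    = z\<^sub>0\<^bsup>-1\<^esup>\<delta>((z\<^sub>1-z\<^sub>2)/z\<^sub>0) Y(u,z\<^sub>1)\<Y>(w\<^sub>1,z\<^sub>2)w\<^sub>2 - z\<^sub>0\<^bsup>-1\<^esup>\<delta>((z\<^sub>2-z\<^sub>1)/(-z\<^sub>0)) \<Y>(w\<^sub>1,z\<^sub>2)Y(u,z\<^sub>1)w\<^sub>2\<close>.
\<close>

definition truncated ::
  "'a set \<Rightarrow> 'a set \<Rightarrow> ('a \<Rightarrow> 'k::ring_1 \<Rightarrow> 'a \<Rightarrow> 'a::complex_vector) \<Rightarrow> bool" where
  "truncated A B I \<longleftrightarrow> (\<forall>a\<in>A. \<forall>b\<in>B. \<forall>k. \<exists>i\<^sub>0. \<forall>i\<ge>i\<^sub>0. I a (k + of_nat i) b = 0)"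

definition jacobi ::
  "'a::complex_vector voa \<Rightarrow> 'a vmodule \<Rightarrow> 'a vmodule \<Rightarrow> 'a vmodule \<Rightarrow>
     ('a \<Rightarrow> 'k::ring_1 \<Rightarrow> 'a \<Rightarrow> 'a) \<Rightarrow> bool" where
  "jacobi V M\<^sub>1 M\<^sub>2 M\<^sub>3 I \<longleftrightarrow>
     (\<forall>u\<in>carr V. \<forall>w\<^sub>1\<in>carr M\<^sub>1. \<forall>w\<^sub>2\<in>carr M\<^sub>2. \<forall>l m k.
        Sum_any (\<lambda>i. ((of_int m :: complex) gchoose i) *\<^sub>C
            I (mode M\<^sub>1 u (l + int i) w\<^sub>1) (of_int m + k - of_nat i) w\<^sub>2) =
        Sum_any (\<lambda>i. ((-1) ^ i * ((of_int l :: complex) gchoose i)) *\<^sub>C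
            mode M\<^sub>3 u (l + m - int i) (I w\<^sub>1 (k + of_nat i) w\<^sub>2)) -
        Sum_any (\<lambda>i. ((-1) powi l * (-1) ^ i * ((of_int l :: complex) gchoose i)) *\<^sub>C
            I w\<^sub>1 (of_int l + k - of_nat i) (mode M\<^sub>2 u (m + int i) w\<^sub>2)))"

definition weak_module :: "'a::complex_vector voa \<Rightarrow> 'a vmodule \<Rightarrow> bool" where
  "weak_module V M \<longleftrightarrow>
     cvec.subspace (carr M) \<and>
     (\<forall>u\<in>carr V. \<forall>n. \<forall>w\<in>carr M. mode M u n w \<in> carr M) \<and>
     (\<forall>n. cbilinear_on (carr V) (carr M) (\<lambda>u. mode M u n)) \<and>
     truncated (carr V) (carr M) (mode M) \<and>
     (\<forall>n. \<forall>w\<in>carr M. mode M (vac V) n w = (if n = -1 then w else 0)) \<and>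
     jacobi V (adjoint V) M M (mode M)"

definition virasoro :: "'a::complex_vector voa \<Rightarrow> complex \<Rightarrow> bool" where
  "virasoro V c \<longleftrightarrow>
     (\<forall>m n. \<forall>w\<in>carr V.
        Lop V (adjoint V) m (Lop V (adjoint V) n w) - Lop V (adjoint V) n (Lop V (adjoint V) m w) =
        of_int (m - n) *\<^sub>C Lop V (adjoint V) (m + n) w +
        (if m + n = 0 then (of_int (m ^ 3 - m) / 12 * c) *\<^sub>C w else 0))"

text \<open>
  Eigenspaces for different eigenvalues are independent, so the span of the weight spaces is their
  direct sum.
\<close>

definition is_voa :: "'a::complex_vector voa \<Rightarrow> bool" where
  "is_voa V \<longleftrightarrow>
     weak_module V (adjoint V) \<and> vac V \<in> carr V \<and> conf V \<in> carr V \<and>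
     (\<forall>u\<in>carr V. mode V u (-1) (vac V) = u \<and> (\<forall>n\<ge>0. mode V u n (vac V) = 0)) \<and>
     (\<forall>u\<in>carr V. \<forall>n. \<forall>w\<in>carr V.
        mode V (Lop V (adjoint V) (-1) u) n w = (- of_int n) *\<^sub>C mode V u (n - 1) w) \<and>
     (\<exists>c. virasoro V c) \<and>
     carr V = cvec.span (\<Union>n::int. wt_space V (adjoint V) (of_int n)) \<and>
     (\<forall>n::int. \<exists>d. has_dim (wt_space V (adjoint V) (of_int n)) d) \<and>
     (\<exists>n\<^sub>0. \<forall>n<n\<^sub>0. wt_space V (adjoint V) (of_int n) = {0})"

definition strong_CFT_type :: "'a::complex_vector voa \<Rightarrow> bool" where
  "strong_CFT_type V \<longleftrightarrow>
     carr V = cvec.span (\<Union>n::nat. wt_space V (adjoint V) (of_nat n)) \<and>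
     wt_space V (adjoint V) 0 = cvec.span {vac V} \<and>
     (\<forall>u\<in>wt_space V (adjoint V) 1. Lop V (adjoint V) 1 u = 0)"

definition quasiprimary :: "'a::complex_vector voa \<Rightarrow> nat \<Rightarrow> 'a \<Rightarrow> bool" where
  "quasiprimary V N u \<longleftrightarrow> u \<in> wt_space V (adjoint V) (of_nat N) \<and> Lop V (adjoint V) 1 u = 0"

definition ordinary_module :: "'a::complex_vector voa \<Rightarrow> 'a vmodule \<Rightarrow> bool" where
  "ordinary_module V M \<longleftrightarrow>
     weak_module V M \<and>
     carr M = cvec.span (\<Union>\<mu>. wt_space V M \<mu>) \<and>
     (\<forall>\<mu>. \<exists>d. has_dim (wt_space V M \<mu>) d) \<and>
     (\<forall>\<mu>. \<exists>i\<^sub>0. \<forall>i\<ge>i\<^sub>0. wt_space V M (\<mu> - of_nat i) = {0})"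

definition irreducible_module :: "'a::complex_vector voa \<Rightarrow> 'a vmodule \<Rightarrow> bool" where
  "irreducible_module V M \<longleftrightarrow>
     carr M \<noteq> {0} \<and>
     (\<forall>S. cvec.subspace S \<and> S \<subseteq> carr M \<and> (\<forall>u\<in>carr V. \<forall>n. \<forall>w\<in>S. mode M u n w \<in> S) \<longrightarrow>
        S = {0} \<or> S = carr M)"

definition simple_voa :: "'a::complex_vector voa \<Rightarrow> bool" where
  "simple_voa V \<longleftrightarrow> irreducible_module V (adjoint V)"

definition equivalent_modules ::
  "'a::complex_vector voa \<Rightarrow> 'a vmodule \<Rightarrow> 'a vmodule \<Rightarrow> bool" where
  "equivalent_modules V M M' \<longleftrightarrow>
     (\<exists>\<Phi>. bij_betw \<Phi> (carr M) (carr M') \<and> clinear_on (carr M) \<Phi> \<and>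
        (\<forall>u\<in>carr V. \<forall>n. \<forall>w\<in>carr M. \<Phi> (mode M u n w) = mode M' u n (\<Phi> w)))"


section \<open>Contragredient modules and invariant forms\<close>

text \<open>
  For \<open>u\<close> of weight \<open>N\<close>, \<open>opp_mode V M N u n\<close> is the coefficient of \<open>z\<^bsup>-n-1\<^esup>\<close> in
  \<open>Y(e\<^bsup>zL(1)\<^esup>(-z\<^bsup>-2\<^esup>)\<^bsup>L(0)\<^esup>u, z\<^bsup>-1\<^esup>)
    = (-1)\<^bsup>N\<^esup> \<Sum>\<^sub>i (1/i!) z\<^bsup>i-2N\<^esup> Y(L(1)\<^bsup>i\<^esup>u, z\<^bsup>-1\<^esup>)\<close>.
\<close>

definition opp_mode ::
  "'a::complex_vector voa \<Rightarrow> 'a vmodule \<Rightarrow> int \<Rightarrow> 'a \<Rightarrow> int \<Rightarrow> 'a \<Rightarrow> 'a" where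
  "opp_mode V M N u n w =
     Sum_any (\<lambda>i. ((-1) powi N / fact i) *\<^sub>C
        mode M ((Lop V (adjoint V) 1 ^^ i) u) (2 * N - n - int i - 2) w)"

text \<open>
  The restricted dual \<open>\<Oplus>\<^sub>\<mu> (M\<^sub>\<mu>)\<^sup>*\<close>: linear functionals on \<open>M\<close> vanishing on all but finitely many
  weight spaces, made total by the value \<open>0\<close> outside \<open>M\<close>.
\<close>

definition restricted_dual ::
  "'a::complex_vector voa \<Rightarrow> 'a vmodule \<Rightarrow> ('a \<Rightarrow> complex) set" where
  "restricted_dual V M =
     {\<phi>. clinear_on (carr M) \<phi> \<and> (\<forall>w. w \<notin> carr M \<longrightarrow> \<phi> w = 0) \<and>
         finite {\<mu>. \<exists>w\<in>wt_space V M \<mu>. \<phi> w \<noteq> 0}}"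

text \<open>
  \<open>M'\<close> is isomorphic to the contragredient of \<open>M\<close>: the action on the restricted dual is
  \<open>\<langle>Y'(u,z)\<phi>, w\<rangle> = \<langle>\<phi>, Y(e\<^bsup>zL(1)\<^esup>(-z\<^bsup>-2\<^esup>)\<^bsup>L(0)\<^esup>u, z\<^bsup>-1\<^esup>)w\<rangle>\<close>. Homogeneous \<open>u\<close> span \<open>V\<close>.
\<close>

definition contragredient ::
  "'a::complex_vector voa \<Rightarrow> 'a vmodule \<Rightarrow> 'a vmodule \<Rightarrow> bool" where
  "contragredient V M M' \<longleftrightarrow>
     (\<exists>\<Phi>. bij_betw \<Phi> (carr M') (restricted_dual V M) \<and> clinear_on (carr M') \<Phi> \<and>
        (\<forall>N. \<forall>u\<in>wt_space V (adjoint V) (of_int N). \<forall>n. \<forall>w'\<in>carr M'. \<forall>w\<in>carr M.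
           \<Phi> (mode M' u n w') w = \<Phi> w' (opp_mode V M N u n w)))"

definition invariant_form :: "'a::complex_vector voa \<Rightarrow> ('a \<Rightarrow> 'a \<Rightarrow> complex) \<Rightarrow> bool" where
  "invariant_form V B \<longleftrightarrow>
     cbilinear_on (carr V) (carr V) B \<and>
     (\<forall>N. \<forall>u\<in>wt_space V (adjoint V) (of_int N). \<forall>n. \<forall>a\<in>carr V. \<forall>b\<in>carr V.
        B (mode V u n a) b = B a (opp_mode V (adjoint V) N u n b))"

definition nondegenerate_form :: "'a::complex_vector voa \<Rightarrow> ('a \<Rightarrow> 'a \<Rightarrow> complex) \<Rightarrow> bool" where
  "nondegenerate_form V B \<longleftrightarrow>
     (\<forall>a\<in>carr V. (\<forall>b\<in>carr V. B a b = 0) \<longrightarrow> a = 0) \<and>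
     (\<forall>b\<in>carr V. (\<forall>a\<in>carr V. B a b = 0) \<longrightarrow> b = 0)"


section \<open>The family of irreducible modules and intertwining operators\<close>

text \<open>
  In the last clause \<open>M\<close> ranges over modules inside the ambient space \<open>'a\<close>. This is no restriction:
  an irreducible ordinary module has countable dimension, so it has a copy inside \<open>'a\<close> when \<open>V\<close> is
  infinite-dimensional, and a simple finite-dimensional \<open>V\<close> of strong CFT type is \<open>\<complex>\<one>\<close>.
\<close>

definition irreducible_family ::
  "'a::complex_vector voa \<Rightarrow> ('i \<Rightarrow> 'a vmodule) \<Rightarrow> ('i \<Rightarrow> complex) \<Rightarrow> bool" where
  "irreducible_family V W h \<longleftrightarrow>
     (\<forall>\<alpha>. ordinary_module V (W \<alpha>) \<and> irreducible_module V (W \<alpha>) \<and>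
        carr (W \<alpha>) = cvec.span (\<Union>n::nat. wt_space V (W \<alpha>) (of_nat n + h \<alpha>))) \<and>
     (\<forall>\<alpha> \<beta>. equivalent_modules V (W \<alpha>) (W \<beta>) \<longrightarrow> \<alpha> = \<beta>) \<and>
     (\<forall>M. ordinary_module V M \<and> irreducible_module V M \<longrightarrow> (\<exists>\<alpha>. equivalent_modules V M (W \<alpha>)))"

text \<open>Intertwining operators of type \<open>(M\<^sub>3 over M\<^sub>1 M\<^sub>2)\<close>, in the notation of \<open>jacobi\<close>.\<close>

definition intertwining_op ::
  "'a::complex_vector voa \<Rightarrow> 'a vmodule \<Rightarrow> 'a vmodule \<Rightarrow> 'a vmodule \<Rightarrow>
     ('a \<Rightarrow> complex \<Rightarrow> 'a \<Rightarrow> 'a) \<Rightarrow> bool" where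
  "intertwining_op V M\<^sub>1 M\<^sub>2 M\<^sub>3 I \<longleftrightarrow>
     (\<forall>w\<^sub>1\<in>carr M\<^sub>1. \<forall>r. \<forall>w\<^sub>2\<in>carr M\<^sub>2. I w\<^sub>1 r w\<^sub>2 \<in> carr M\<^sub>3) \<and>
     (\<forall>r. cbilinear_on (carr M\<^sub>1) (carr M\<^sub>2) (\<lambda>w\<^sub>1. I w\<^sub>1 r)) \<and>
     truncated (carr M\<^sub>1) (carr M\<^sub>2) I \<and>
     jacobi V M\<^sub>1 M\<^sub>2 M\<^sub>3 I \<and>
     (\<forall>w\<^sub>1\<in>carr M\<^sub>1. \<forall>r. \<forall>w\<^sub>2\<in>carr M\<^sub>2.
        I (Lop V M\<^sub>1 (-1) w\<^sub>1) r w\<^sub>2 = (- r) *\<^sub>C I w\<^sub>1 (r - 1) w\<^sub>2)"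

text \<open>
  \<open>has_fusion_number V M\<^sub>1 M\<^sub>2 M\<^sub>3 d\<close> says that \<open>N\<^bsub>M\<^sub>1 M\<^sub>2\<^esub>\<^bsup>M\<^sub>3\<^esup> = d\<close>. To count each operator once,
  it is represented by the function vanishing outside \<open>M\<^sub>1 \<times> M\<^sub>2\<close>.
\<close>

definition has_fusion_number ::
  "'a::complex_vector voa \<Rightarrow> 'a vmodule \<Rightarrow> 'a vmodule \<Rightarrow> 'a vmodule \<Rightarrow> nat \<Rightarrow> bool" where
  "has_fusion_number V M\<^sub>1 M\<^sub>2 M\<^sub>3 d \<longleftrightarrow>
     has_dim {I. intertwining_op V M\<^sub>1 M\<^sub>2 M\<^sub>3 I \<and>
                 (\<forall>w\<^sub>1 r w\<^sub>2. w\<^sub>1 \<notin> carr M\<^sub>1 \<or> w\<^sub>2 \<notin> carr M\<^sub>2 \<longrightarrow> I w\<^sub>1 r w\<^sub>2 = 0)} d"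

definition complex_modes :: "'a vmodule \<Rightarrow> 'a \<Rightarrow> complex \<Rightarrow> 'a \<Rightarrow> 'a::complex_vector" where
  "complex_modes M u r w = (if r \<in> \<int> then mode M u \<lfloor>Re r\<rfloor> w else 0)"


section \<open>Formal series in variables with complex exponents\<close>

text \<open>
  \<open>F e\<close> is the coefficient of \<open>\<Prod>\<^sub>k y\<^sub>k\<^bsup>e k\<^esup>\<close>. The variables are \<open>x = y\<^sub>0\<close> and \<open>y\<^sub>1, y\<^sub>2, \<dots>\<close>; a series
  not involving \<open>y\<^sub>k\<close> is supported on exponents with \<open>e k = 0\<close>. Addition is pointwise.
\<close>

type_synonym formal_series = "(nat \<Rightarrow> complex) \<Rightarrow> complex"

text \<open>
  The Cauchy product; it is only meaningful if each coefficient is a finite sum. This holds for all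
  products used here: the real parts of the exponents of \<open>y\<^sub>1\<close> in a correlation function are
  bounded above, and its total degree takes finitely many values. The ordinary \<open>*\<close> on functions is pointwise and not
  used.
\<close>

definition fs_mult :: "formal_series \<Rightarrow> formal_series \<Rightarrow> formal_series"  (infixl "\<odot>" 70) where
  "F \<odot> G = (\<lambda>e. Sum_any (\<lambda>d. F d * G (e - d)))"

definition fs_deriv :: "nat \<Rightarrow> formal_series \<Rightarrow> formal_series" where
  "fs_deriv k F = (\<lambda>e. (e k + 1) * F (e(k := e k + 1)))"

text \<open>\<open>(1/j!) \<partial>\<^bsup>j\<^esup>F/\<partial>y\<^sub>k\<^bsup>j\<^esup>\<close>\<close>

definition divided_deriv :: "nat \<Rightarrow> nat \<Rightarrow> formal_series \<Rightarrow> formal_series" where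
  "divided_deriv k j F = (1 / fact j) *\<^sub>C (fs_deriv k ^^ j) F"

text \<open>The one-variable series \<open>f(y\<^sub>k)\<close>\<close>

definition in_var :: "nat \<Rightarrow> complex fls \<Rightarrow> formal_series" where
  "in_var k f =
     (\<lambda>e. if (\<forall>m. m \<noteq> k \<longrightarrow> e m = 0) \<and> e k \<in> \<int> then fls_nth f \<lfloor>Re (e k)\<rfloor> else 0)"

definition poly_in_var :: "nat \<Rightarrow> complex poly \<Rightarrow> formal_series" where
  "poly_in_var k p = in_var k (fps_to_fls (fps_of_poly p))"

text \<open>\<open>(y\<^sub>a - y\<^sub>b)\<^bsup>-1\<^esup> = \<Sum>\<^sub>i\<^sub>\<ge>\<^sub>0 y\<^sub>a\<^bsup>-i-1\<^esup> y\<^sub>b\<^bsup>i\<^esup>\<close>, for \<open>a \<noteq> b\<close>\<close>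

definition inverse_diff :: "nat \<Rightarrow> nat \<Rightarrow> formal_series" where
  "inverse_diff a b =
     (\<lambda>e. if (\<forall>m. m \<noteq> a \<and> m \<noteq> b \<longrightarrow> e m = 0) \<and>
             (\<exists>i::nat. e a = - of_nat i - 1 \<and> e b = of_nat i) then 1 else 0)"

text \<open>\<open>\<pi>\<^sub>N(y\<^sub>a,y\<^sub>b)\<close>, \<open>\<pi>\<^sub>N\<^bsup>(i,j)\<^esup>(y\<^sub>a,y\<^sub>b)\<close> (for \<open>a \<noteq> b\<close>), and \<open>e\<^sub>i\<^bsup>j\<^esup>(y\<^sub>k)\<close>\<close>

definition pi_series ::
  "nat \<Rightarrow> (nat \<Rightarrow> complex fls) \<Rightarrow> nat \<Rightarrow> nat \<Rightarrow> formal_series" where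
  "pi_series N f a b =
     inverse_diff a b + (\<Sum>l=0..2*N-2. in_var a (f l) \<odot> in_var b (fls_X ^ l))"

definition pi_deriv ::
  "nat \<Rightarrow> (nat \<Rightarrow> complex fls) \<Rightarrow> nat \<Rightarrow> nat \<Rightarrow> nat \<Rightarrow> nat \<Rightarrow> formal_series" where
  "pi_deriv N f i j a b = divided_deriv a i (divided_deriv b j (pi_series N f a b))"

definition e_series ::
  "nat \<Rightarrow> (nat \<Rightarrow> complex fls) \<Rightarrow> nat \<Rightarrow> nat \<Rightarrow> nat \<Rightarrow> formal_series" where
  "e_series N f i j k =
     (\<Sum>l=0..2*N-2. divided_deriv k i (in_var k (f l)) \<odot> divided_deriv k j (in_var k (fls_X ^ l)))"


section \<open>Genus zero correlation functions\<close>

text \<open>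
  \<open>\<Y> \<alpha> \<beta> \<gamma>\<close> is the fixed intertwining operator of type \<open>(\<gamma> over \<alpha> \<beta>)\<close>. \<open>chain \<dots> e\<close> is the
  coefficient of \<open>\<Prod>\<^sub>k y\<^sub>k\<^bsup>e k\<^esup>\<close> in
  \<open>\<Y>\<^bsub>\<alpha>\<^sub>1 \<beta>\<^sub>1\<^esub>\<^bsup>\<beta>\<^sub>0\<^esup>(v\<^sub>1,y\<^sub>1) \<cdots> \<Y>\<^bsub>\<alpha>\<^sub>n \<beta>\<^sub>n\<^esub>\<^bsup>\<beta>\<^bsub>n-1\<^esub>\<^esup>(v\<^sub>n,y\<^sub>n)\<one>\<close>, where the outer labels \<open>\<beta>\<^sub>0, \<beta>\<^sub>n\<close> are the label
  \<open>0\<close> of \<open>V\<close>.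
\<close>

definition chain ::
  "'a voa \<Rightarrow> ('i \<Rightarrow> 'i \<Rightarrow> 'i \<Rightarrow> 'a \<Rightarrow> complex \<Rightarrow> 'a \<Rightarrow> 'a) \<Rightarrow>
     nat \<Rightarrow> (nat \<Rightarrow> 'i) \<Rightarrow> (nat \<Rightarrow> 'i) \<Rightarrow> (nat \<Rightarrow> 'a) \<Rightarrow> (nat \<Rightarrow> complex) \<Rightarrow> 'a" where
  "chain V \<Y> n \<alpha> \<beta> v e =
     foldr (\<lambda>k. \<Y> (\<alpha> k) (\<beta> k) (\<beta> (k - 1)) (v k) (- e k - 1)) [1..<Suc n] (vac V)"

definition Z0 ::
  "'a voa \<Rightarrow> ('a \<Rightarrow> 'a \<Rightarrow> complex) \<Rightarrow> ('i \<Rightarrow> 'i \<Rightarrow> 'i \<Rightarrow> 'a \<Rightarrow> complex \<Rightarrow> 'a \<Rightarrow> 'a) \<Rightarrow>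
     nat \<Rightarrow> (nat \<Rightarrow> 'i) \<Rightarrow> (nat \<Rightarrow> 'i) \<Rightarrow> (nat \<Rightarrow> 'a) \<Rightarrow> formal_series" where
  "Z0 V B \<Y> n \<alpha> \<beta> v =
     (\<lambda>e. if \<forall>k. k \<notin> {1..n} \<longrightarrow> e k = 0 then B (vac V) (chain V \<Y> n \<alpha> \<beta> v e) else 0)"

text \<open>The same with \<open>Y(u,x)\<close>, \<open>x = y\<^sub>0\<close>, inserted on the left\<close>

definition Z0_insert ::
  "'a::complex_vector voa \<Rightarrow> ('a \<Rightarrow> 'a \<Rightarrow> complex) \<Rightarrow>
     ('i \<Rightarrow> 'i \<Rightarrow> 'i \<Rightarrow> 'a \<Rightarrow> complex \<Rightarrow> 'a \<Rightarrow> 'a) \<Rightarrow>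
     nat \<Rightarrow> (nat \<Rightarrow> 'i) \<Rightarrow> (nat \<Rightarrow> 'i) \<Rightarrow> 'a \<Rightarrow> (nat \<Rightarrow> 'a) \<Rightarrow> formal_series" where
  "Z0_insert V B \<Y> n \<alpha> \<beta> u v =
     (\<lambda>e. if \<forall>k. k \<notin> {0..n} \<longrightarrow> e k = 0
          then B (vac V) (complex_modes (adjoint V) u (- e 0 - 1) (chain V \<Y> n \<alpha> \<beta> v e)) else 0)"

end

theory Submission imports Defs begin

text \<open>
  All three identities come from moving the modes of \<open>u\<close> through the product
  \<open>P = \<Y>(v\<^sub>1,y\<^sub>1) \<cdots> \<Y>(v\<^sub>n,y\<^sub>n)\<one>\<close> and comparing coefficients.

  The Jacobi identity gives the commutator
  \<open>[u(m), \<Y>(w,y)] = \<Sum>\<^sub>j binom(m,j) y\<^bsup>m-j\<^esup> \<Y>(u(j)w,y)\<close> for \<open>m \<ge> 0\<close>, and \<open>u(m)\<one> = 0\<close> there, so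
  \<open>\<langle>\<one>, u(m)P\<rangle>\<close> is the sum over \<open>k\<close> and \<open>j\<close> of \<open>binom(m,j) y\<^sub>k\<^bsup>m-j\<^esup>\<close> times the correlation function
  with \<open>u(j)\<close> applied to \<open>v\<^sub>k\<close> (\<open>vacuum_pairing_commutator\<close>). On the other hand, up to sign the adjoint of \<open>u(m)\<close>
  for a quasiprimary \<open>u\<close> of weight \<open>N\<close> is \<open>u(2N-2-m)\<close>, which kills \<open>\<one>\<close> as soon as \<open>m \<le> 2N-2\<close>
  (\<open>vacuum_pairing_quasiprimary_mode\<close>). For \<open>0 \<le> m \<le> 2N-2\<close> both facts together are identity (1) for
  the monomial \<open>y\<^bsup>m\<^esup>\<close> (\<open>ward_identity\<close>).

  For (2), \<open>\<langle>\<one>, Y(u,x)P\<rangle> = \<Sum>\<^sub>m x\<^bsup>-m-1\<^esup> \<langle>\<one>, u(m)P\<rangle>\<close>, in which the modes with \<open>m < 0\<close> contribute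
  nothing. Since \<open>\<Sum>\<^sub>m\<^sub>\<ge>\<^sub>0 binom(m,j) x\<^bsup>-m-1\<^esup> y\<^bsup>m-j\<^esup> = (1/j!) \<partial>\<^sub>y\<^bsup>j\<^esup> (x-y)\<^bsup>-1\<^esup>\<close>, the commutator formula sums to the
  polar part of \<open>\<pi>\<^sub>N\<close>; each \<open>f\<^sub>l\<close> multiplies the identity (1) for \<open>y\<^bsup>l\<^esup>\<close> with \<open>l \<le> 2N-2\<close>, so it drops out.

  For (3), another case of the Jacobi identity writes \<open>\<Y>(u(-i-1)v\<^sub>1,y\<^sub>1)\<close> as a sum of products with a
  negative mode of \<open>u\<close> on the left, which the pairing with \<open>\<one>\<close> kills, and of products with \<open>u(m)\<close>,
  \<open>m \<ge> 0\<close>, on the right (\<open>jacobi_iterate\<close>). The latter modes are commuted through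
  \<open>\<Y>(v\<^sub>2,y\<^sub>2) \<cdots> \<Y>(v\<^sub>n,y\<^sub>n)\<one>\<close> and yield \<open>(1/i!) \<partial>\<^bsup>i\<^esup>\<close> of the polar parts at \<open>y\<^sub>2, \<dots>, y\<^sub>n\<close>. The
  \<open>f\<^sub>l\<close>-terms, which at \<open>y\<^sub>1\<close> are collected in \<open>e\<^sub>i\<^bsup>j\<^esup>\<close>, again add up to multiples of (1).

  What needs care is that the products of formal series exist, that is, that each coefficient is a
  finite sum. For (2) the exponent of \<open>x\<close> decides this. For (3) it is the boundedness of the exponents
  of \<open>y\<^sub>1\<close>: from above because \<open>\<langle>\<one>, \<cdot>\<rangle>\<close> sees only weight \<open>0\<close> and weights of modules are bounded below
  (\<open>vacuum_pairing_intertwining_bounded\<close>), and from below, once the other exponents are fixed, by the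
  truncation axiom (\<open>kernel_exponent_range\<close>).
\<close>

section \<open>Sums and coefficients of formal series\<close>

lemma sum_fun_apply: "(\<Sum>i\<in>I. F i) x = (\<Sum>i\<in>I. F i x)"
  by (induction I rule: infinite_finite_induct) auto

text \<open>
  The form in which every \<^const>\<open>Sum_any\<close> below is evaluated: its support is covered by the
  injective image of an explicit finite index set.
\<close>

lemma Sum_any_eq_sum_reindex:
  assumes "finite S" and "inj_on \<phi> S" and "\<And>x. x \<notin> \<phi> ` S \<Longrightarrow> g x = 0"
  shows "Sum_any g = (\<Sum>y\<in>S. g (\<phi> y))"
proof -
  have "Sum_any g = sum g (\<phi> ` S)"
    using assms by (intro Sum_any.expand_superset) auto
  also have "\<dots> = (\<Sum>y\<in>S. g (\<phi> y))"
    using assms by (simp add: sum.reindex)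
  finally show ?thesis .
qed

lemma Sum_any_sum:
  assumes "finite L" and "\<And>l. l \<in> L \<Longrightarrow> finite {x. g l x \<noteq> 0}"
  shows "Sum_any (\<lambda>x. \<Sum>l\<in>L. g l x) = (\<Sum>l\<in>L. Sum_any (g l))"
  using assms
proof (induction L rule: finite_induct)
  case (insert l L)
  have "finite {x. (\<Sum>l\<in>L. g l x) \<noteq> 0}"
    by (rule finite_subset[of _ "\<Union>l\<in>L. {x. g l x \<noteq> 0}"])
      (use insert in \<open>auto dest: sum.not_neutral_contains_not_neutral\<close>)
  then show ?case
    using insert by (simp add: Sum_any.distrib)
qed simp

lemma sum_swap3:
  "(\<Sum>k\<in>K. \<Sum>j\<in>L. \<Sum>m\<in>A. g k j m) = (\<Sum>m\<in>A. \<Sum>k\<in>K. \<Sum>j\<in>L. g k j m)"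
proof -
  have "(\<Sum>k\<in>K. \<Sum>j\<in>L. \<Sum>m\<in>A. g k j m) = (\<Sum>k\<in>K. \<Sum>m\<in>A. \<Sum>j\<in>L. g k j m)"
    by (intro sum.cong refl sum.swap)
  also have "\<dots> = (\<Sum>m\<in>A. \<Sum>k\<in>K. \<Sum>j\<in>L. g k j m)"
    by (rule sum.swap)
  finally show ?thesis .
qed

lemma sum_swap4:
  "(\<Sum>k\<in>K. \<Sum>j\<in>L. \<Sum>l\<in>A. \<Sum>s\<in>R. g k j l s) = (\<Sum>l\<in>A. \<Sum>s\<in>R. \<Sum>k\<in>K. \<Sum>j\<in>L. g k j l s)"
  by (rule trans[OF sum_swap3 sum.cong[OF refl sum_swap3]])

text \<open>
  The commutator formula with \<open>u(m)\<close> sums over \<open>j \<le> m\<close>, which depends on the mode; vanishing of \<open>x j\<close>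
  for large \<open>j\<close> replaces this by one range for all modes, so that sums over \<open>m\<close> and \<open>j\<close> can be swapped.
\<close>

lemma sum_gbinomial_truncate:
  fixes x :: "nat \<Rightarrow> complex"
  assumes "\<And>j. j \<ge> J \<Longrightarrow> x j = 0"
  shows "(\<Sum>j\<le>m. (of_nat m gchoose j) * x j) = (\<Sum>j<J. (of_nat m gchoose j) * x j)"
proof -
  have "(\<Sum>j\<le>m. (of_nat m gchoose j) * x j) = Sum_any (\<lambda>j. (of_nat m gchoose j) * x j)"
    by (rule Sum_any_eq_sum_reindex[where \<phi> = "\<lambda>j. j", symmetric])
      (auto simp: binomial_gbinomial[symmetric] binomial_eq_0)
  also have "\<dots> = (\<Sum>j<J. (of_nat m gchoose j) * x j)"
    by (rule Sum_any_eq_sum_reindex[where \<phi> = "\<lambda>j. j"]) (auto simp: assms)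
  finally show ?thesis .
qed

lemma fs_deriv_iterate:
  "(fs_deriv k ^^ j) F e = pochhammer (e k + 1) j * F (e(k := e k + of_nat j))"
proof (induction j arbitrary: e)
  case (Suc j)
  have "(fs_deriv k ^^ Suc j) F e = (e k + 1) * (fs_deriv k ^^ j) F (e(k := e k + 1))"
    by (simp add: fs_deriv_def)
  also have "\<dots> = (e k + 1) * (pochhammer (e k + 1 + 1) j * F (e(k := e k + 1 + of_nat j)))"
    by (simp only: Suc.IH fun_upd_same fun_upd_upd)
  finally show ?case
    by (simp only: pochhammer_rec of_nat_Suc mult.assoc add.assoc)
qed simp

lemma divided_deriv_coeff:
  "divided_deriv k j F e = ((e k + of_nat j) gchoose j) * F (e(k := e k + of_nat j))"
  by (simp add: divided_deriv_def scaleC_fun_def scaleC_complex_def fs_deriv_iterate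
      gbinomial_pochhammer')

lemma fs_mult_commute: "F \<odot> G = G \<odot> F"
proof
  fix e :: "nat \<Rightarrow> complex"
  have "bij (\<lambda>d. e - d)"
    by (rule involuntory_imp_bij) (simp add: fun_eq_iff)
  then show "(F \<odot> G) e = (G \<odot> F) e"
    unfolding fs_mult_def by (rule Sum_any.reindex_cong) (simp add: fun_eq_iff mult.commute fun_diff_def)
qed

lemma fs_mult_nonzeroE:
  assumes "(F \<odot> G) e \<noteq> 0"
  obtains d where "F d \<noteq> 0" and "G (e - d) \<noteq> 0"
proof -
  obtain d where "F d * G (e - d) \<noteq> 0"
    using assms unfolding fs_mult_def by (rule Sum_any.not_neutral_obtains_not_neutral)
  then show ?thesis using that by auto
qed

lemma fs_mult_zero_left: "0 \<odot> G = 0" and fs_mult_zero_right: "F \<odot> 0 = 0"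
  by (simp_all add: fs_mult_def fun_eq_iff)

text \<open>
  The exponent of \<open>y\<^sub>k\<^bsup>t\<^esup>\<close>. The kernels have integral exponents in one or two variables, so a product
  with them is a sum over \<^typ>\<open>int\<close> or \<^typ>\<open>int \<times> int\<close> along these parametrisations.
\<close>

definition expo1 :: "nat \<Rightarrow> int \<Rightarrow> nat \<Rightarrow> complex" where
  "expo1 k t = (\<lambda>_. 0)(k := of_int t)"

definition expo2 :: "nat \<Rightarrow> nat \<Rightarrow> int \<times> int \<Rightarrow> nat \<Rightarrow> complex" where
  "expo2 a b = (\<lambda>(s, t). (\<lambda>_. 0)(a := of_int s, b := of_int t))"

lemma inj_expo1: "inj (expo1 k)"
  by (rule injI) (metis expo1_def fun_upd_same of_int_eq_iff)

lemma inj_expo2: "a \<noteq> b \<Longrightarrow> inj (expo2 a b)"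
  by (rule injI) (auto simp: expo2_def fun_eq_iff split: if_splits)

text \<open>
  The index sets of the two sums correspond under \<open>\<phi>\<close> as they stand, so finiteness only has to be
  dealt with after the sum has become one over integers.
\<close>

lemma fs_mult_coeff_reindex:
  assumes "inj \<phi>" and "\<And>d. F d \<noteq> 0 \<Longrightarrow> d \<in> range \<phi>"
  shows "(F \<odot> G) e = Sum_any (\<lambda>x. F (\<phi> x) * G (e - \<phi> x))"
proof -
  have "(F \<odot> G) e = sum (\<lambda>d. F d * G (e - d)) (\<phi> ` {x. F (\<phi> x) * G (e - \<phi> x) \<noteq> 0})"
    unfolding fs_mult_def Sum_any.expand_set
    by (rule arg_cong[where f = "sum _"]) (use assms(2) in auto)
  also have "\<dots> = Sum_any (\<lambda>x. F (\<phi> x) * G (e - \<phi> x))"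
    using assms(1) by (simp add: sum.reindex inj_on_def Sum_any.expand_set)
  finally show ?thesis .
qed

lemma in_var_expo1: "in_var k f (expo1 k t) = fls_nth f t"
  by (simp add: in_var_def expo1_def)

lemma in_var_support:
  assumes "in_var k f d \<noteq> 0"
  shows "d \<in> range (expo1 k)"
proof -
  have d: "\<And>m. m \<noteq> k \<Longrightarrow> d m = 0" "d k \<in> \<int>"
    using assms by (auto simp: in_var_def split: if_splits)
  then obtain t where "d k = of_int t"
    by (auto elim: Ints_cases)
  then have "d = expo1 k t"
    using d by (auto simp: expo1_def)
  then show ?thesis by blast
qed

lemma divided_deriv_in_var_expo1:
  "divided_deriv k i (in_var k f) (expo1 k t)
     = ((of_int t + of_nat i) gchoose i) * fls_nth f (t + int i)"
proof -
  have "(expo1 k t)(k := expo1 k t k + of_nat i) = expo1 k (t + int i)"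
    by (simp add: expo1_def)
  then show ?thesis
    by (simp add: divided_deriv_coeff in_var_expo1) (simp add: expo1_def)
qed

lemma divided_deriv_in_var_support:
  assumes "divided_deriv k i (in_var k f) d \<noteq> 0"
  shows "d \<in> range (expo1 k)"
proof -
  have "in_var k f (d(k := d k + of_nat i)) \<noteq> 0"
    using assms by (auto simp: divided_deriv_coeff)
  then obtain t where t: "d(k := d k + of_nat i) = expo1 k t"
    using in_var_support by blast
  have "d = expo1 k (t - int i)"
  proof
    fix m show "d m = expo1 k (t - int i) m"
      using fun_cong[OF t, of m] by (auto simp: expo1_def split: if_splits simp: algebra_simps)
  qed
  then show ?thesis by blast
qed

lemma minus_expo1: "e - expo1 k t = e(k := e k - of_int t)"
  by (auto simp: expo1_def fun_eq_iff)

lemma minus_expo2: "a \<noteq> b \<Longrightarrow> e - expo2 a b (s, t) = e(a := e a - of_int s, b := e b - of_int t)"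
  by (auto simp: expo2_def fun_eq_iff)

lemma poly_product_coeff:
  assumes "degree p \<le> D"
  shows "(divided_deriv k j (poly_in_var k p) \<odot> G) e =
    (\<Sum>l\<le>D. coeff p l * (of_nat l gchoose j) * G (e(k := e k - of_nat l + of_nat j)))"
proof -
  let ?P = "fps_to_fls (fps_of_poly p)"
  have "(divided_deriv k j (poly_in_var k p) \<odot> G) e =
      Sum_any (\<lambda>t. ((of_int t + of_nat j) gchoose j) * fls_nth ?P (t + int j)
        * G (e(k := e k - of_int t)))"
    unfolding poly_in_var_def
    by (subst fs_mult_coeff_reindex[OF inj_expo1[of k]])
      (simp_all add: divided_deriv_in_var_support divided_deriv_in_var_expo1 minus_expo1)
  also have "\<dots> = (\<Sum>l\<le>D. ((of_int (int l - int j) + of_nat j) gchoose j)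
      * fls_nth ?P (int l - int j + int j) * G (e(k := e k - of_int (int l - int j))))"
  proof (rule Sum_any_eq_sum_reindex)
    fix t assume t: "t \<notin> (\<lambda>l. int l - int j) ` {..D}"
    have "fls_nth ?P (t + int j) = 0"
    proof (cases "t + int j \<ge> 0")
      case True
      then have "nat (t + int j) \<notin> {..D}"
        using t True by (force simp: image_iff)
      then show ?thesis
        using True assms by (simp add: coeff_eq_0)
    qed simp
    then show "((of_int t + of_nat j) gchoose j) * fls_nth ?P (t + int j)
        * G (e(k := e k - of_int t)) = 0" by simp
  qed (auto simp: inj_on_def)
  finally show ?thesis
    by (simp add: mult.commute[of "coeff _ _"] diff_diff_eq2 diff_add_eq)
qed

lemma divided_deriv_product_expo1:
  "(divided_deriv k i (in_var k f) \<odot> divided_deriv k j (in_var k (fls_X ^ l))) (expo1 k t) =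
     ((of_int (t + int j - int l) + of_nat i) gchoose i) * fls_nth f (t + int j - int l + int i)
       * (of_nat l gchoose j)"
proof -
  have "expo1 k t - expo1 k s = expo1 k (t - s)" for s
    by (auto simp: expo1_def)
  then have "(divided_deriv k i (in_var k f) \<odot> divided_deriv k j (in_var k (fls_X ^ l))) (expo1 k t)
      = Sum_any (\<lambda>s. ((of_int s + of_nat i) gchoose i) * fls_nth f (s + int i) *
          (((of_int (t - s) + of_nat j) gchoose j) * fls_nth (fls_X ^ l) (t - s + int j)))"
    by (subst fs_mult_coeff_reindex[OF inj_expo1[of k]])
      (simp_all add: divided_deriv_in_var_support divided_deriv_in_var_expo1 del: of_int_diff)
  also have "\<dots> = (\<Sum>s\<in>{t + int j - int l}. ((of_int s + of_nat i) gchoose i) * fls_nth f (s + int i) *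
          (((of_int (t - s) + of_nat j) gchoose j) * fls_nth (fls_X ^ l) (t - s + int j)))"
    by (rule Sum_any_eq_sum_reindex[where \<phi> = "\<lambda>s. s"]) auto
  finally show ?thesis by simp
qed

lemma divided_deriv_product_support:
  assumes "(divided_deriv k i (in_var k f) \<odot> divided_deriv k j (in_var k g)) d \<noteq> 0"
  shows "d \<in> range (expo1 k)"
proof -
  obtain s where "divided_deriv k j (in_var k g) (d - expo1 k s) \<noteq> 0"
    using assms by (elim fs_mult_nonzeroE) (use divided_deriv_in_var_support in blast)
  then obtain t where "d - expo1 k s = expo1 k t"
    using divided_deriv_in_var_support by blast
  then have "d = expo1 k (s + t)"
    by (auto simp: expo1_def fun_eq_iff algebra_simps split: if_splits)
  then show ?thesis by blast
qed

text \<open>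
  The finite set \<open>R\<close> bounds the exponents \<open>s\<close> of \<open>y\<^sub>k\<close> contributed by \<open>f\<^sub>l\<^bsup>(i)\<^esup>\<close>; it is what makes the
  product of a Laurent series in \<open>y\<^sub>k\<close> with a series unbounded in \<open>y\<^sub>k\<close> a finite sum.
\<close>

lemma e_series_product_coeff:
  assumes "finite R"
    and R: "\<And>l s. l \<le> 2 * N - 2 \<Longrightarrow> s \<notin> R \<Longrightarrow>
      fls_nth (f l) (s + int i) * G (e(k := e k - of_int s - of_nat l + of_nat j)) = 0"
  shows "(e_series N f i j k \<odot> G) e = (\<Sum>l=0..2*N-2. \<Sum>s\<in>R.
     ((of_int s + of_nat i) gchoose i) * fls_nth (f l) (s + int i) * (of_nat l gchoose j)
       * G (e(k := e k - of_int s - of_nat l + of_nat j)))"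
proof -
  define E where "E l = divided_deriv k i (in_var k (f l)) \<odot> divided_deriv k j (in_var k (fls_X ^ l))"
    for l
  define T where "T l t = E l (expo1 k t) * G (e(k := e k - of_int t))" for l t
  have supp: "d \<in> range (expo1 k)" if "e_series N f i j k d \<noteq> 0" for d
  proof -
    have "(\<Sum>l=0..2*N-2. E l d) \<noteq> 0"
      using that by (simp add: e_series_def E_def sum_fun_apply)
    then obtain l where "E l d \<noteq> 0"
      by (meson sum.not_neutral_contains_not_neutral)
    then show ?thesis
      unfolding E_def by (rule divided_deriv_product_support)
  qed
  have zero: "T l t = 0" if "l \<le> 2 * N - 2" "t \<notin> (\<lambda>s. s + int l - int j) ` R" for l t
  proof -
    have "t + int j - int l \<notin> R"
      using that(2) by (force simp: image_iff)
    from R[OF that(1) this] show ?thesis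
      by (auto simp: T_def E_def divided_deriv_product_expo1)
  qed
  have "(e_series N f i j k \<odot> G) e = Sum_any (\<lambda>t. \<Sum>l=0..2*N-2. T l t)"
    using supp by (subst fs_mult_coeff_reindex[OF inj_expo1[of k]])
      (simp_all add: e_series_def sum_fun_apply E_def T_def sum_distrib_right minus_expo1)
  also have "\<dots> = (\<Sum>l=0..2*N-2. Sum_any (T l))"
  proof (rule Sum_any_sum)
    fix l assume "l \<in> {0..2 * N - 2}"
    then show "finite {t. T l t \<noteq> 0}"
      by (intro finite_subset[OF _ finite_imageI[OF \<open>finite R\<close>, of "\<lambda>s. s + int l - int j"]])
        (use zero in auto)
  qed simp
  also have "\<dots> = (\<Sum>l=0..2*N-2. \<Sum>s\<in>R. T l (s + int l - int j))"
    by (intro sum.cong refl Sum_any_eq_sum_reindex) (use \<open>finite R\<close> zero in \<open>auto simp: inj_on_def\<close>)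
  finally show ?thesis
    by (simp add: T_def E_def divided_deriv_product_expo1 algebra_simps)
qed

lemma in_var_product_expo2:
  assumes "a \<noteq> b"
  shows "(in_var a f \<odot> in_var b g) (expo2 a b (s, t)) = fls_nth f s * fls_nth g t"
proof -
  have *: "in_var b g (expo2 a b (s, t) - expo1 a s') = (if s' = s then fls_nth g t else 0)" for s'
    using assms by (auto simp: in_var_def expo1_def expo2_def)
  have "(in_var a f \<odot> in_var b g) (expo2 a b (s, t)) =
      Sum_any (\<lambda>s'. fls_nth f s' * in_var b g (expo2 a b (s, t) - expo1 a s'))"
    by (subst fs_mult_coeff_reindex[OF inj_expo1[of a]]) (simp_all add: in_var_support in_var_expo1)
  also have "\<dots> = (\<Sum>s'\<in>{s}. fls_nth f s' * in_var b g (expo2 a b (s, t) - expo1 a s'))"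
    by (rule Sum_any_eq_sum_reindex[where \<phi> = "\<lambda>s. s"]) (auto simp: *)
  finally show ?thesis by (simp add: *)
qed

lemma in_var_product_support:
  assumes "(in_var a f \<odot> in_var b g) d \<noteq> 0" and "a \<noteq> b"
  shows "d \<in> range (expo2 a b)"
proof -
  obtain s where "in_var b g (d - expo1 a s) \<noteq> 0"
    using assms(1) by (elim fs_mult_nonzeroE) (use in_var_support in blast)
  then obtain t where "d - expo1 a s = expo1 b t"
    using in_var_support by blast
  then have "d = expo2 a b (s, t)"
    using \<open>a \<noteq> b\<close> by (auto simp: expo1_def expo2_def fun_eq_iff algebra_simps split: if_splits)
  then show ?thesis by blast
qed

lemma inverse_diff_expo2:
  assumes "a \<noteq> b"
  shows "inverse_diff a b (expo2 a b (s, t)) = (if t \<ge> 0 \<and> s = - t - 1 then 1 else 0)"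
proof -
  have "of_int s = - of_nat i - (1::complex) \<longleftrightarrow> s = - int i - 1" for i
  proof -
    have "- of_nat i - (1::complex) = of_int (- int i - 1)" by simp
    then show ?thesis by (simp only: of_int_eq_iff)
  qed
  moreover have "of_int t = (of_nat i :: complex) \<longleftrightarrow> t = int i" for i
    using of_int_eq_iff[of t "int i", where 'a = complex] by simp
  ultimately have "(\<exists>i::nat. of_int s = - of_nat i - (1::complex) \<and> of_int t = (of_nat i :: complex))
      \<longleftrightarrow> (\<exists>i::nat. s = - int i - 1 \<and> t = int i)"
    by (simp only:)
  also have "\<dots> \<longleftrightarrow> t \<ge> 0 \<and> s = - t - 1"
    by (auto intro: exI[of _ "nat t"])
  finally show ?thesis
    using assms by (simp add: inverse_diff_def expo2_def)
qed

lemma inverse_diff_support: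
  assumes "inverse_diff a b d \<noteq> 0" and "a \<noteq> b"
  shows "d \<in> range (expo2 a b)"
proof -
  obtain i :: nat where d: "\<And>m. m \<noteq> a \<Longrightarrow> m \<noteq> b \<Longrightarrow> d m = 0" "d a = - of_nat i - 1" "d b = of_nat i"
    using assms by (auto simp: inverse_diff_def split: if_splits)
  then have "d = expo2 a b (- int i - 1, int i)"
    using \<open>a \<noteq> b\<close> by (auto simp: expo2_def fun_eq_iff)
  then show ?thesis by blast
qed

lemma pi_series_support:
  assumes "pi_series N f a b d \<noteq> 0" and "a \<noteq> b"
  shows "d \<in> range (expo2 a b)"
proof (cases "inverse_diff a b d = 0")
  case True
  then have "(\<Sum>l=0..2*N-2. (in_var a (f l) \<odot> in_var b (fls_X ^ l)) d) \<noteq> 0"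
    using assms by (simp add: pi_series_def sum_fun_apply)
  then obtain l where "(in_var a (f l) \<odot> in_var b (fls_X ^ l)) d \<noteq> 0"
    by (meson sum.not_neutral_contains_not_neutral)
  then show ?thesis using in_var_product_support assms(2) by blast
qed (use inverse_diff_support assms(2) in blast)

lemma pi_deriv_support:
  assumes "pi_deriv N f i j a b d \<noteq> 0" and "a \<noteq> b"
  shows "d \<in> range (expo2 a b)"
proof -
  have "pi_series N f a b (d(a := d a + of_nat i, b := d b + of_nat j)) \<noteq> 0"
    using assms by (auto simp: pi_deriv_def divided_deriv_coeff)
  then obtain s t where st: "d(a := d a + of_nat i, b := d b + of_nat j) = expo2 a b (s, t)"
    using pi_series_support assms(2) by (metis (no_types, lifting) imageE surj_pair)
  have "d = expo2 a b (s - int i, t - int j)"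
  proof
    fix m show "d m = expo2 a b (s - int i, t - int j) m"
      using fun_cong[OF st, of m] \<open>a \<noteq> b\<close>
      by (auto simp: expo2_def algebra_simps split: if_splits)
  qed
  then show ?thesis by blast
qed

lemma pi_deriv_expo2:
  assumes "a \<noteq> b"
  shows "pi_deriv N f i j a b (expo2 a b (s, t)) =
    ((of_int s + of_nat i) gchoose i) * ((of_int t + of_nat j) gchoose j) *
      ((if t + int j \<ge> 0 \<and> s + int i = - (t + int j) - 1 then 1 else 0) +
       (\<Sum>l=0..2*N-2. if t + int j = int l then fls_nth (f l) (s + int i) else 0))"
proof -
  have *: "(expo2 a b (s, t))(a := of_int s + of_nat i, b := of_int t + of_nat j)
      = expo2 a b (s + int i, t + int j)"
    by (auto simp: expo2_def fun_eq_iff)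
  have ab: "expo2 a b (s, t) a = of_int s" "expo2 a b (s, t) b = of_int t"
    using assms by (auto simp: expo2_def)
  have "(\<Sum>l=0..2*N-2. fls_nth (f l) (s + int i) * fls_nth (fls_X ^ l :: complex fls) (t + int j))
      = (\<Sum>l=0..2*N-2. if t + int j = int l then fls_nth (f l) (s + int i) else 0)"
    by (intro sum.cong) auto
  then show ?thesis
    using assms by (simp add: pi_deriv_def divided_deriv_coeff ab * pi_series_def sum_fun_apply
        in_var_product_expo2 inverse_diff_expo2)
qed

text \<open>
  The first sum comes from \<open>(y\<^sub>a - y\<^sub>b)\<^bsup>-1\<^esup>\<close>, whose term \<open>y\<^sub>a\<^bsup>-m-1\<^esup> y\<^sub>b\<^bsup>m\<^esup>\<close> has the divided derivative
  \<open>binom(-m-1,i) binom(m,j) y\<^sub>a\<^bsup>-m-1-i\<^esup> y\<^sub>b\<^bsup>m-j\<^esup>\<close>; the second comes from the terms \<open>f\<^sub>l(y\<^sub>a) y\<^sub>b\<^bsup>l\<^esup>\<close>. Both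
  are infinite a priori, and \<open>M\<close> and \<open>R\<close> say where the other factor cuts them off.
\<close>

lemma pi_deriv_product_coeff:
  assumes "a \<noteq> b" and "finite R"
    and M: "\<And>m. m \<ge> M \<Longrightarrow>
      G (e(a := e a + of_nat m + 1 + of_nat i, b := e b - of_nat m + of_nat j)) = 0"
    and R: "\<And>l s. l \<le> 2 * N - 2 \<Longrightarrow> s \<notin> R \<Longrightarrow>
      fls_nth (f l) (s + int i) * G (e(a := e a - of_int s, b := e b - of_nat l + of_nat j)) = 0"
  shows "(pi_deriv N f i j a b \<odot> G) e =
    (\<Sum>m<M. ((- of_nat m - 1) gchoose i) * (of_nat m gchoose j)
        * G (e(a := e a + of_nat m + 1 + of_nat i, b := e b - of_nat m + of_nat j))) +
    (\<Sum>l=0..2*N-2. \<Sum>s\<in>R.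
        ((of_int s + of_nat i) gchoose i) * fls_nth (f l) (s + int i) * (of_nat l gchoose j)
          * G (e(a := e a - of_int s, b := e b - of_nat l + of_nat j)))"
proof -
  define g where "g = (\<lambda>(s::int, t::int). ((of_int s + of_nat i) gchoose i) * ((of_int t + of_nat j) gchoose j)
      * G (e(a := e a - of_int s, b := e b - of_int t)))"
  define P where "P = (\<lambda>(s, t). (if t + int j \<ge> 0 \<and> s + int i = - (t + int j) - 1 then g (s, t) else 0))"
  define Q where "Q l = (\<lambda>(s, t). if t + int j = int l then fls_nth (f l) (s + int i) * g (s, t) else 0)"
    for l
  define \<phi> where "\<phi> m = (- int m - 1 - int i, int m - int j)" for m
  define \<psi> where "\<psi> l s = (s :: int, int l - int j)" for l s
  have P_zero: "P x = 0" if "x \<notin> \<phi> ` {..<M}" for x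
  proof (rule ccontr)
    obtain s t where x: "x = (s, t)" by force
    assume "P x \<noteq> 0"
    then have st: "t + int j \<ge> 0" "s + int i = - (t + int j) - 1" and "g (s, t) \<noteq> 0"
      by (auto simp: P_def x split: if_splits)
    define m where "m = nat (t + int j)"
    have s: "s = - int m - 1 - int i" and t: "t = int m - int j"
      using st by (auto simp: m_def)
    then have "x = \<phi> m" by (simp add: x \<phi>_def)
    then have "m \<ge> M" using that by force
    from M[OF this] have "g (s, t) = 0"
      by (simp add: g_def s t algebra_simps)
    with \<open>g (s, t) \<noteq> 0\<close> show False ..
  qed
  have Q_zero: "Q l x = 0" if "l \<le> 2 * N - 2" "x \<notin> \<psi> l ` R" for l x
  proof (rule ccontr)
    obtain s t where x: "x = (s, t)" by force
    assume "Q l x \<noteq> 0"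
    then have t: "t = int l - int j" and nz: "fls_nth (f l) (s + int i) * g (s, t) \<noteq> 0"
      by (auto simp: Q_def x split: if_splits)
    then have "s \<notin> R" using that(2) by (auto simp: x \<psi>_def)
    from R[OF that(1) this] nz show False
      by (auto simp: g_def t algebra_simps)
  qed
  have fin_P: "finite {x. P x \<noteq> 0}"
    by (rule finite_subset[of _ "\<phi> ` {..<M}"]) (use P_zero in auto)
  have fin_Q: "finite {x. Q l x \<noteq> 0}" if "l \<le> 2 * N - 2" for l
    by (rule finite_subset[of _ "\<psi> l ` R"]) (use Q_zero[OF that] \<open>finite R\<close> in auto)
  have fin_sum_Q: "finite {x. (\<Sum>l=0..2*N-2. Q l x) \<noteq> 0}"
    by (rule finite_subset[of _ "\<Union>l\<in>{0..2*N-2}. {x. Q l x \<noteq> 0}"])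
      (use fin_Q in \<open>auto dest: sum.not_neutral_contains_not_neutral\<close>)
  have P_eq: "P (\<phi> m) = ((- of_nat m - 1) gchoose i) * (of_nat m gchoose j)
        * G (e(a := e a + of_nat m + 1 + of_nat i, b := e b - of_nat m + of_nat j))" for m
  proof -
    have "of_int (- int m - 1 - int i) + of_nat i = - of_nat m - (1 :: complex)"
      and "of_int (int m - int j) + of_nat j = (of_nat m :: complex)"
      and "e a - of_int (- int m - 1 - int i) = e a + of_nat m + 1 + of_nat i"
      and "e b - of_int (int m - int j) = e b - of_nat m + of_nat j"
      by simp_all
    then have "g (\<phi> m) = ((- of_nat m - 1) gchoose i) * (of_nat m gchoose j)
        * G (e(a := e a + of_nat m + 1 + of_nat i, b := e b - of_nat m + of_nat j))"
      by (simp only: g_def \<phi>_def split_conv)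
    then show ?thesis
      by (simp add: P_def \<phi>_def)
  qed
  have Q_eq: "Q l (\<psi> l s) = ((of_int s + of_nat i) gchoose i) * fls_nth (f l) (s + int i)
      * (of_nat l gchoose j) * G (e(a := e a - of_int s, b := e b - of_nat l + of_nat j))" for l s
    by (simp add: Q_def \<psi>_def g_def algebra_simps)
  have "pi_deriv N f i j a b (expo2 a b x) * G (e - expo2 a b x) = P x + (\<Sum>l=0..2*N-2. Q l x)" for x
  proof -
    obtain s t where x: "x = (s, t)" by force
    have "g (s, t) * (\<Sum>l=0..2*N-2. if t + int j = int l then fls_nth (f l) (s + int i) else 0)
        = (\<Sum>l=0..2*N-2. Q l (s, t))"
      by (simp add: sum_distrib_left Q_def if_distrib mult.commute cong: if_cong)
    moreover have "pi_deriv N f i j a b (expo2 a b x) * G (e - expo2 a b x) =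
        g (s, t) * (if t + int j \<ge> 0 \<and> s + int i = - (t + int j) - 1 then 1 else 0) +
        g (s, t) * (\<Sum>l=0..2*N-2. if t + int j = int l then fls_nth (f l) (s + int i) else 0)"
      unfolding x pi_deriv_expo2[OF \<open>a \<noteq> b\<close>] minus_expo2[OF \<open>a \<noteq> b\<close>]
      by (simp only: g_def split_conv) (simp only: algebra_simps)
    ultimately show ?thesis
      by (simp add: P_def x)
  qed
  then have "(pi_deriv N f i j a b \<odot> G) e = Sum_any (\<lambda>x. P x + (\<Sum>l=0..2*N-2. Q l x))"
    using pi_deriv_support[OF _ \<open>a \<noteq> b\<close>]
    by (subst fs_mult_coeff_reindex[OF inj_expo2[OF \<open>a \<noteq> b\<close>]]) auto
  also have "\<dots> = Sum_any P + (\<Sum>l=0..2*N-2. Sum_any (Q l))"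
    by (subst Sum_any.distrib[OF fin_P fin_sum_Q], subst Sum_any_sum) (use fin_Q in auto)
  also have "Sum_any P = (\<Sum>m<M. P (\<phi> m))"
    by (rule Sum_any_eq_sum_reindex) (use P_zero in \<open>auto simp: inj_on_def \<phi>_def\<close>)
  also have "(\<Sum>l=0..2*N-2. Sum_any (Q l)) = (\<Sum>l=0..2*N-2. \<Sum>s\<in>R. Q l (\<psi> l s))"
    by (intro sum.cong refl Sum_any_eq_sum_reindex)
      (use Q_zero \<open>finite R\<close> in \<open>auto simp: inj_on_def \<psi>_def\<close>)
  finally show ?thesis
    by (simp only: P_eq Q_eq)
qed

section \<open>Modes and intertwining operators\<close>

lemma clinear_on_zero:
  assumes "cvec.subspace S" and "clinear_on S g"
  shows "g 0 = 0"
proof -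
  have "g (0 *\<^sub>C 0) = 0 *\<^sub>C g 0"
    using assms cvec.subspace_0 unfolding clinear_on_def by blast
  then show ?thesis by simp
qed

lemma clinear_on_sum:
  assumes "cvec.subspace S" and "clinear_on S g" and "\<And>i. i \<in> I \<Longrightarrow> x i \<in> S"
  shows "g (\<Sum>i\<in>I. x i) = (\<Sum>i\<in>I. g (x i))"
  using assms(3)
proof (induction I rule: infinite_finite_induct)
  case (insert i I)
  then have "(\<Sum>i\<in>I. x i) \<in> S" "x i \<in> S"
    using assms(1) by (auto intro: cvec.subspace_sum)
  with insert show ?case
    using assms(2) by (simp add: clinear_on_def)
qed (simp_all add: clinear_on_zero[OF assms(1,2)])

lemma clinear_on_span_zero:
  assumes "clinear_on (cvec.span X) g" and "\<And>x. x \<in> X \<Longrightarrow> g x = 0" and "x \<in> cvec.span X"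
  shows "g x = 0"
proof -
  have "x \<in> cvec.span X \<and> g x = 0"
    using assms(3)
  proof (induction rule: cvec.span_induct_alt)
    case base
    show ?case
      using clinear_on_zero[OF cvec.subspace_span assms(1)] by (simp add: cvec.span_zero)
  next
    case (step c x y)
    then have "c *\<^sub>C x \<in> cvec.span X" "x \<in> cvec.span X"
      by (auto intro: cvec.span_base cvec.span_scale)
    then show ?case
      using step assms(1,2) by (simp add: cvec.span_add clinear_on_def)
  qed
  then show ?thesis ..
qed

lemma cbilinear_onD:
  assumes "cbilinear_on S T g"
  shows "a \<in> S \<Longrightarrow> clinear_on T (g a)" and "b \<in> T \<Longrightarrow> clinear_on S (\<lambda>a. g a b)"
  using assms by (auto simp: cbilinear_on_def)

lemma carr_adjoint [simp]: "carr (adjoint V) = carr V" and mode_adjoint [simp]: "mode (adjoint V) = mode V"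
  by (simp_all add: adjoint_def)

lemma weak_moduleD:
  assumes "weak_module V M"
  shows "cvec.subspace (carr M)"
    and "u \<in> carr V \<Longrightarrow> w \<in> carr M \<Longrightarrow> mode M u n w \<in> carr M"
    and "u \<in> carr V \<Longrightarrow> clinear_on (carr M) (mode M u n)"
    and "w \<in> carr M \<Longrightarrow> clinear_on (carr V) (\<lambda>u. mode M u n w)"
    and "truncated (carr V) (carr M) (mode M)"
  using assms by (auto simp: weak_module_def intro: cbilinear_onD)

lemma intertwining_opD:
  assumes "intertwining_op V M1 M2 M3 I"
  shows "w1 \<in> carr M1 \<Longrightarrow> w2 \<in> carr M2 \<Longrightarrow> I w1 r w2 \<in> carr M3"
    and "w1 \<in> carr M1 \<Longrightarrow> clinear_on (carr M2) (I w1 r)"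
    and "w2 \<in> carr M2 \<Longrightarrow> clinear_on (carr M1) (\<lambda>w1. I w1 r w2)"
    and "truncated (carr M1) (carr M2) I"
    and "jacobi V M1 M2 M3 I"
    and "w1 \<in> carr M1 \<Longrightarrow> w2 \<in> carr M2 \<Longrightarrow> I (Lop V M1 (-1) w1) r w2 = (- r) *\<^sub>C I w1 (r - 1) w2"
  using assms by (auto simp: intertwining_op_def intro: cbilinear_onD)

lemma truncated_mode:
  assumes "weak_module V M" and "u \<in> carr V" and "w \<in> carr M"
  obtains J :: nat where "\<And>j. j \<ge> J \<Longrightarrow> mode M u (int j) w = 0"
proof -
  obtain J where "\<forall>j\<ge>J. mode M u (0 + of_nat j) w = 0"
    using weak_moduleD(5)[OF assms(1)] assms(2,3) unfolding truncated_def by blast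
  then show ?thesis using that[of J] by simp
qed

lemma truncated_eventually:
  fixes I :: "'a \<Rightarrow> 'k::ring_1 \<Rightarrow> 'a \<Rightarrow> 'a::complex_vector"
  assumes "truncated S T I" and "a \<in> S" and "b \<in> T"
  shows "eventually (\<lambda>s::int. I a (k + of_int s) b = 0) at_top"
proof -
  obtain i0 where i0: "\<And>i. i \<ge> i0 \<Longrightarrow> I a (k + of_nat i) b = 0"
    using assms unfolding truncated_def by blast
  have "I a (k + of_int s) b = 0" if "s \<ge> int i0" for s
    using i0[of "nat s"] that by simp
  then show ?thesis
    unfolding eventually_at_top_linorder by blast
qed

text \<open>
  The Jacobi identity at \<open>l = 0\<close>: there \<open>binom(l,i)\<close> vanishes for \<open>i > 0\<close>, so each of the two sums on
  the right-hand side has a single term.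
\<close>

lemma jacobi_commutator:
  fixes I :: "'a \<Rightarrow> complex \<Rightarrow> 'a \<Rightarrow> 'a::complex_vector"
  assumes "jacobi V M1 M2 M3 I" and "u \<in> carr V" and "w1 \<in> carr M1" and "w2 \<in> carr M2"
  shows "mode M3 u (int m) (I w1 r w2) =
    (\<Sum>j\<le>m. (of_nat m gchoose j) *\<^sub>C I (mode M1 u (int j) w1) (r + of_nat m - of_nat j) w2) +
    I w1 r (mode M2 u (int m) w2)"
proof -
  have gb: "(0::complex) gchoose i = (if i = 0 then 1 else 0)" for i
    by (cases i) auto
  have "Sum_any (\<lambda>i. ((of_int (int m) :: complex) gchoose i) *\<^sub>C
            I (mode M1 u (0 + int i) w1) (of_int (int m) + r - of_nat i) w2) =
        Sum_any (\<lambda>i. ((-1) ^ i * ((of_int 0 :: complex) gchoose i)) *\<^sub>C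
            mode M3 u (0 + int m - int i) (I w1 (r + of_nat i) w2)) -
        Sum_any (\<lambda>i. ((-1) powi 0 * (-1) ^ i * ((of_int 0 :: complex) gchoose i)) *\<^sub>C
            I w1 (of_int 0 + r - of_nat i) (mode M2 u (int m + int i) w2))"
    using assms unfolding jacobi_def by blast
  also have "Sum_any (\<lambda>i. ((of_int (int m) :: complex) gchoose i) *\<^sub>C
            I (mode M1 u (0 + int i) w1) (of_int (int m) + r - of_nat i) w2) =
      (\<Sum>j\<le>m. ((of_int (int m) :: complex) gchoose j) *\<^sub>C
            I (mode M1 u (0 + int j) w1) (of_int (int m) + r - of_nat j) w2)"
    by (rule Sum_any_eq_sum_reindex[where \<phi> = "\<lambda>j. j"])
      (auto simp: binomial_gbinomial[symmetric] binomial_eq_0)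
  also have "Sum_any (\<lambda>i. ((-1) ^ i * ((of_int 0 :: complex) gchoose i)) *\<^sub>C
            mode M3 u (0 + int m - int i) (I w1 (r + of_nat i) w2)) =
      (\<Sum>i\<in>{0}. ((-1) ^ i * ((of_int 0 :: complex) gchoose i)) *\<^sub>C
            mode M3 u (0 + int m - int i) (I w1 (r + of_nat i) w2))"
    by (rule Sum_any_eq_sum_reindex[where \<phi> = "\<lambda>j. j"]) (auto simp: gb)
  also have "Sum_any (\<lambda>i. ((-1) powi 0 * (-1) ^ i * ((of_int 0 :: complex) gchoose i)) *\<^sub>C
            I w1 (of_int 0 + r - of_nat i) (mode M2 u (int m + int i) w2)) =
      (\<Sum>i\<in>{0}. ((-1) powi 0 * (-1) ^ i * ((of_int 0 :: complex) gchoose i)) *\<^sub>C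
            I w1 (of_int 0 + r - of_nat i) (mode M2 u (int m + int i) w2))"
    by (rule Sum_any_eq_sum_reindex[where \<phi> = "\<lambda>j. j"]) (auto simp: gb)
  finally show ?thesis
    by (simp add: scaleC_one add.commute eq_diff_eq)
qed

text \<open>
  The right-hand side is symmetric in \<open>i\<close> and \<open>m\<close>. This exchanges the coefficient \<open>binom(-i-1,m)\<close>
  that the Jacobi identity produces for \<open>u(m)\<close> with the coefficient \<open>binom(-m-1,i)\<close> of the \<open>i\<close>-th divided
  derivative of \<open>x\<^bsup>-m-1\<^esup>\<close>.
\<close>

lemma signed_gbinomial_negative:
  "(-1) ^ m * ((- of_nat i - 1 :: complex) gchoose m) = of_nat ((m + i) choose m)"
proof -
  have "- of_nat i - (1::complex) = - (of_nat i + 1)"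
    and "of_nat i + 1 + of_nat m - 1 = (of_nat (m + i) :: complex)"
    by simp_all
  then show ?thesis
    by (simp only: gbinomial_minus binomial_gbinomial left_minus_one_mult_self)
qed

text \<open>
  The Jacobi identity at \<open>m = 0\<close> and \<open>l = -i-1\<close>: now the left-hand side has a single term.
  \<open>J\<close> and \<open>M\<close> are where the two remaining sums stop. The coefficients of the second sum are written as those
  of the \<open>i\<close>-th divided derivative of \<open>y\<^bsup>-m-1\<^esup>\<close>, the form in which they occur in \<open>\<pi>\<^sub>N\<^bsup>(i,j)\<^esup>\<close>.
\<close>

lemma jacobi_iterate:
  fixes I :: "'a \<Rightarrow> complex \<Rightarrow> 'a \<Rightarrow> 'a::complex_vector"
  assumes "intertwining_op V M1 M2 M3 I" and "weak_module V M2" and "weak_module V M3"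
    and "u \<in> carr V" and "w1 \<in> carr M1" and "w2 \<in> carr M2"
    and J: "\<And>j. j \<ge> J \<Longrightarrow> I w1 (r + of_nat j) w2 = 0"
    and M: "\<And>m. m \<ge> M \<Longrightarrow> mode M2 u (int m) w2 = 0"
  shows "I (mode M1 u (- int i - 1) w1) r w2 =
    (\<Sum>j<J. ((-1) ^ j * ((- of_nat i - 1) gchoose j)) *\<^sub>C
        mode M3 u (- int i - 1 - int j) (I w1 (r + of_nat j) w2)) +
    (\<Sum>m<M. ((- of_nat m - 1) gchoose i) *\<^sub>C
        I w1 (r - of_nat m - 1 - of_nat i) (mode M2 u (int m) w2))"
proof -
  let ?l = "- int i - 1"
  have gb: "(0::complex) gchoose i = (if i = 0 then 1 else 0)" for i
    by (cases i) auto
  have zero3: "mode M3 u k 0 = 0" for k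
    using clinear_on_zero[OF weak_moduleD(1,3)[OF assms(3)]] assms(4) by blast
  have zeroI: "I w1 k 0 = 0" for k
    using clinear_on_zero[OF weak_moduleD(1)[OF assms(2)] intertwining_opD(2)[OF assms(1)]] assms(5)
    by blast
  have "Sum_any (\<lambda>j. ((of_int 0 :: complex) gchoose j) *\<^sub>C
            I (mode M1 u (?l + int j) w1) (of_int 0 + r - of_nat j) w2) =
        Sum_any (\<lambda>j. ((-1) ^ j * ((of_int ?l :: complex) gchoose j)) *\<^sub>C
            mode M3 u (?l + 0 - int j) (I w1 (r + of_nat j) w2)) -
        Sum_any (\<lambda>m. ((-1) powi ?l * (-1) ^ m * ((of_int ?l :: complex) gchoose m)) *\<^sub>C
            I w1 (of_int ?l + r - of_nat m) (mode M2 u (0 + int m) w2))"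
    using intertwining_opD(5)[OF assms(1)] assms(4-6) unfolding jacobi_def by blast
  also have "Sum_any (\<lambda>j. ((of_int 0 :: complex) gchoose j) *\<^sub>C
            I (mode M1 u (?l + int j) w1) (of_int 0 + r - of_nat j) w2) =
      (\<Sum>j\<in>{0}. ((of_int 0 :: complex) gchoose j) *\<^sub>C
            I (mode M1 u (?l + int j) w1) (of_int 0 + r - of_nat j) w2)"
    by (rule Sum_any_eq_sum_reindex[where \<phi> = "\<lambda>j. j"]) (auto simp: gb)
  also have "Sum_any (\<lambda>j. ((-1) ^ j * ((of_int ?l :: complex) gchoose j)) *\<^sub>C
            mode M3 u (?l + 0 - int j) (I w1 (r + of_nat j) w2)) =
      (\<Sum>j<J. ((-1) ^ j * ((of_int ?l :: complex) gchoose j)) *\<^sub>C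
            mode M3 u (?l + 0 - int j) (I w1 (r + of_nat j) w2))"
    by (rule Sum_any_eq_sum_reindex[where \<phi> = "\<lambda>j. j"]) (auto simp: J zero3)
  also have "Sum_any (\<lambda>m. ((-1) powi ?l * (-1) ^ m * ((of_int ?l :: complex) gchoose m)) *\<^sub>C
            I w1 (of_int ?l + r - of_nat m) (mode M2 u (0 + int m) w2)) =
      (\<Sum>m<M. ((-1) powi ?l * (-1) ^ m * ((of_int ?l :: complex) gchoose m)) *\<^sub>C
            I w1 (of_int ?l + r - of_nat m) (mode M2 u (0 + int m) w2))"
    by (rule Sum_any_eq_sum_reindex[where \<phi> = "\<lambda>j. j"]) (auto simp: M zeroI)
  also have "\<dots> = - (\<Sum>m<M. ((- of_nat m - 1) gchoose i) *\<^sub>C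
        I w1 (r - of_nat m - 1 - of_nat i) (mode M2 u (int m) w2))"
    unfolding sum_negf[symmetric]
  proof (intro sum.cong refl)
    fix m
    have "(-1) ^ m * ((of_int ?l :: complex) gchoose m) = of_nat ((m + i) choose m)"
      using signed_gbinomial_negative[of m i] by simp
    moreover have "(-1) ^ i * ((- of_nat m - 1 :: complex) gchoose i) = of_nat ((m + i) choose m)"
      using signed_gbinomial_negative[of i m] binomial_symmetric[of m "m + i"]
      by (simp add: add.commute)
    moreover have "(-1 :: complex) powi ?l = - ((-1) ^ i)"
      by (cases "even i") (simp_all add: power_int_diff power_int_minus)
    ultimately have "(-1) powi ?l * (-1) ^ m * ((of_int ?l :: complex) gchoose m)
        = - ((- of_nat m - 1) gchoose i)"
      by (simp add: mult.assoc) (metis left_minus_one_mult_self mult.assoc)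
    moreover have "of_int ?l + r - of_nat m = r - of_nat m - 1 - of_nat i"
      by simp
    ultimately show "((-1) powi ?l * (-1) ^ m * ((of_int ?l :: complex) gchoose m)) *\<^sub>C
        I w1 (of_int ?l + r - of_nat m) (mode M2 u (0 + int m) w2)
      = - (((- of_nat m - 1) gchoose i) *\<^sub>C
        I w1 (r - of_nat m - 1 - of_nat i) (mode M2 u (int m) w2))"
      by (simp only: add_0 cvec.scale_minus_left)
  qed
  finally show ?thesis
    by (simp add: scaleC_one)
qed

section \<open>Pairing with the vacuum\<close>

text \<open>
  Since \<open>L(1)u = 0\<close>, invariance of the form makes \<open>(-1)\<^bsup>N\<^esup> u(2N-2-m)\<close> the adjoint of \<open>u(m)\<close>, and this
  is a non-negative mode, which annihilates the vacuum. The case \<open>0 \<le> m\<close> gives the Ward identities, and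
  the case \<open>m < 0\<close> removes the negative modes of \<open>u\<close> from the expansions.
\<close>

lemma vacuum_pairing_quasiprimary_mode:
  assumes "is_voa V" and "invariant_form V B" and "quasiprimary V N u"
    and "b \<in> carr V" and "m \<le> 2 * int N - 2"
  shows "B (vac V) (mode V u m b) = 0"
proof -
  have V: "weak_module V (adjoint V)" and vac: "vac V \<in> carr V" and conf: "conf V \<in> carr V"
    and creation: "\<And>u n. u \<in> carr V \<Longrightarrow> n \<ge> 0 \<Longrightarrow> mode V u n (vac V) = 0"
    using assms(1) by (auto simp: is_voa_def)
  have wt: "u \<in> wt_space V (adjoint V) (of_int (int N))" and L1: "Lop V (adjoint V) 1 u = 0"
    using assms(3) by (auto simp: quasiprimary_def)
  then have u: "u \<in> carr V"
    by (simp add: wt_space_def)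
  have B: "cbilinear_on (carr V) (carr V) B"
    using assms(2) by (simp add: invariant_form_def)
  have sub: "cvec.subspace (carr V)"
    using weak_moduleD(1)[OF V] by simp
  \<comment> \<open>The mode of the vacuum whose adjoint is \<open>u(m)\<close>; it is non-negative by the bound on \<open>m\<close>.\<close>
  define n where "n = 2 * int N - 2 - m"
  have L1_pow: "(Lop V (adjoint V) 1 ^^ i) u = 0" if "i \<noteq> 0" for i
  proof -
    have "(Lop V (adjoint V) 1 ^^ Suc k) u = 0" for k
      using clinear_on_zero[OF weak_moduleD(1,3)[OF V]] conf
      by (induction k) (simp_all add: L1, simp add: Lop_def)
    with that show ?thesis
      by (cases i) blast+
  qed
  have mode_zero: "mode V 0 k b = 0" for k
    using clinear_on_zero[OF sub weak_moduleD(4)[OF V]] assms(4) by simp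
  have "opp_mode V (adjoint V) (int N) u n b =
      (\<Sum>i\<in>{0}. ((-1) powi int N / fact i) *\<^sub>C
        mode (adjoint V) ((Lop V (adjoint V) 1 ^^ i) u) (2 * int N - n - int i - 2) b)"
    unfolding opp_mode_def
    by (rule Sum_any_eq_sum_reindex[where \<phi> = "\<lambda>i. i"]) (auto simp: L1_pow mode_zero)
  then have opp: "opp_mode V (adjoint V) (int N) u n b = ((-1) powi int N) *\<^sub>C mode V u m b"
    by (simp add: n_def)
  have "B (vac V) (((-1) powi int N) *\<^sub>C mode V u m b) = B (mode V u n (vac V)) b"
    using assms(2,4) wt vac unfolding invariant_form_def opp[symmetric] by metis
  also have "mode V u n (vac V) = 0"
    using creation[OF u] assms(5) by (simp add: n_def)
  also have "B 0 b = 0"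
    using clinear_on_zero[OF sub cbilinear_onD(2)[OF B assms(4)]] .
  finally have "((-1) powi int N) * B (vac V) (mode V u m b) = 0"
    using cbilinear_onD(1)[OF B vac] weak_moduleD(2)[OF V] u assms(4)
    by (simp add: clinear_on_def scaleC_complex_def)
  then show ?thesis by simp
qed

text \<open>
  By the creation axiom \<open>\<omega> = L(-2)\<one>\<close>, and the Virasoro relations move \<open>L(0)\<close> and \<open>L(1)\<close> to the vacuum. So
  the vanishing of vacuum pairings also applies to \<open>\<omega>\<close>, where it says that \<open>\<langle>\<one>, L(0)b\<rangle> = 0\<close>.
\<close>

lemma quasiprimary_conf:
  assumes "is_voa V"
  shows "quasiprimary V 2 (conf V)"
proof -
  let ?L = "Lop V (adjoint V)"
  have V: "weak_module V (adjoint V)" and vac: "vac V \<in> carr V" and conf: "conf V \<in> carr V"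
    and creation: "mode V (conf V) (-1) (vac V) = conf V"
      "\<And>n. n \<ge> 0 \<Longrightarrow> mode V (conf V) n (vac V) = 0"
    using assms by (auto simp: is_voa_def)
  obtain c where "virasoro V c"
    using assms by (auto simp: is_voa_def)
  then have vir: "?L m (?L n (vac V)) - ?L n (?L m (vac V)) = of_int (m - n) *\<^sub>C ?L (m + n) (vac V) +
        (if m + n = 0 then (of_int (m ^ 3 - m) / 12 * c) *\<^sub>C vac V else 0)" for m n
    using vac by (simp add: virasoro_def)
  have L_zero: "?L n 0 = 0" for n
    using clinear_on_zero[OF weak_moduleD(1,3)[OF V]] conf by (simp add: Lop_def)
  have L_vac: "?L n (vac V) = 0" if "n \<ge> -1" for n
    using creation(2) that by (simp add: Lop_def)
  have conf_eq: "?L (-2) (vac V) = conf V"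
    using creation(1) by (simp add: Lop_def)
  have "?L 0 (conf V) = 2 *\<^sub>C conf V"
    using vir[of 0 "-2"] by (simp add: L_vac L_zero conf_eq)
  moreover have "?L 1 (conf V) = 0"
    using vir[of 1 "-2"] by (simp add: L_vac L_zero conf_eq)
  ultimately show ?thesis
    using conf by (simp add: quasiprimary_def wt_space_def)
qed

text \<open>
  The commutator with \<open>L(0) = \<omega>(1)\<close>, in which the \<open>L(-1)\<close>-derivative property evaluates the term with
  \<open>L(-1)w\<^sub>1 = \<omega>(0)w\<^sub>1\<close>.
\<close>

lemma intertwining_op_weight:
  assumes I: "intertwining_op V M1 M2 M3 I" and conf: "conf V \<in> carr V"
    and w: "w1 \<in> wt_space V M1 a" "w2 \<in> wt_space V M2 b"
  shows "Lop V M3 0 (I w1 r w2) = (a + b - r - 1) *\<^sub>C I w1 r w2"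
proof -
  have w1: "w1 \<in> carr M1" and L1: "mode M1 (conf V) 1 w1 = a *\<^sub>C w1"
    and w2: "w2 \<in> carr M2" and L2: "mode M2 (conf V) 1 w2 = b *\<^sub>C w2"
    using w by (auto simp: wt_space_def Lop_def)
  have "Lop V M3 0 (I w1 r w2) = mode M3 (conf V) (int 1) (I w1 r w2)"
    by (simp add: Lop_def)
  also have "\<dots> = I (mode M1 (conf V) 0 w1) (r + 1) w2 + I (mode M1 (conf V) 1 w1) r w2
      + I w1 r (mode M2 (conf V) 1 w2)"
    unfolding jacobi_commutator[OF intertwining_opD(5)[OF I] conf w1 w2]
    by (simp add: atMost_Suc scaleC_one)
  also have "I (mode M1 (conf V) 0 w1) (r + 1) w2 = (- (r + 1)) *\<^sub>C I w1 r w2"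
    using intertwining_opD(6)[OF I w1 w2, of "r + 1"] by (simp add: Lop_def)
  also have "I (mode M1 (conf V) 1 w1) r w2 = a *\<^sub>C I w1 r w2"
    using intertwining_opD(3)[OF I w2] w1 by (simp add: L1 clinear_on_def)
  also have "I w1 r (mode M2 (conf V) 1 w2) = b *\<^sub>C I w1 r w2"
    using intertwining_opD(2)[OF I w1] w2 by (simp add: L2 clinear_on_def)
  also have "(- (r + 1)) *\<^sub>C I w1 r w2 + a *\<^sub>C I w1 r w2 + b *\<^sub>C I w1 r w2
      = (- (r + 1) + a + b) *\<^sub>C I w1 r w2"
    by (simp only: scaleC_add_left)
  also have "- (r + 1) + a + b = a + b - r - 1"
    by simp
  finally show ?thesis .
qed

text \<open>
  As \<open>\<langle>\<one>, L(0)b\<rangle> = 0\<close>, the vacuum is orthogonal to homogeneous vectors of non-zero weight. The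
  weight of \<open>I w\<^sub>1 r w\<^sub>2\<close> is the sum of the weights of \<open>w\<^sub>1\<close> and \<open>w\<^sub>2\<close> minus \<open>r + 1\<close>, and its real part is positive
  for the \<open>r\<close> below. The bound is uniform in \<open>w\<^sub>1\<close> and \<open>w\<^sub>2\<close>; this matters because in
  \<open>\<pi>\<^sub>N(y\<^sub>1,y\<^sub>k)\<close> the vector \<open>w\<^sub>2\<close> varies along with the exponent of \<open>y\<^sub>1\<close>.
\<close>

lemma vacuum_pairing_intertwining_bounded:
  assumes V: "is_voa V" and B: "invariant_form V B"
    and I: "intertwining_op V M1 M2 (adjoint V) I"
    and span1: "carr M1 = cvec.span (\<Union>n::nat. wt_space V M1 (of_nat n + h1))"
    and span2: "carr M2 = cvec.span (\<Union>n::nat. wt_space V M2 (of_nat n + h2))"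
    and w: "w1 \<in> carr M1" "w2 \<in> carr M2" and r: "Re r < Re h1 + Re h2 - 1"
  shows "B (vac V) (I w1 r w2) = 0"
proof -
  have vac: "vac V \<in> carr V" and conf: "conf V \<in> carr V"
    using V by (auto simp: is_voa_def)
  have lin: "clinear_on (carr V) (B (vac V))"
    using B vac unfolding invariant_form_def by (blast intro: cbilinear_onD)
  have homogeneous: "B (vac V) (I x r y) = 0"
    if x: "x \<in> wt_space V M1 (of_nat p + h1)" and y: "y \<in> wt_space V M2 (of_nat q + h2)" for x y p q
  proof -
    let ?a = "of_nat p + h1 + (of_nat q + h2) - r - 1"
    have carr: "I x r y \<in> carr V"
      using intertwining_opD(1)[OF I] x y by (simp add: wt_space_def)
    have "0 = B (vac V) (Lop V (adjoint V) 0 (I x r y))"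
      using vacuum_pairing_quasiprimary_mode[OF V B quasiprimary_conf[OF V] carr, of 1]
      by (simp add: Lop_def)
    also have "\<dots> = ?a * B (vac V) (I x r y)"
      unfolding intertwining_op_weight[OF I conf x y]
      using lin carr by (simp add: clinear_on_def scaleC_complex_def)
    finally have "?a = 0 \<or> B (vac V) (I x r y) = 0"
      by auto
    moreover have "Re ?a > 0"
      using r by simp
    then have "?a \<noteq> 0" by (metis less_irrefl zero_complex.simps(1))
    ultimately show ?thesis by blast
  qed
  have right: "B (vac V) (I x r w2) = 0" if x: "x \<in> wt_space V M1 (of_nat p + h1)" for x p
  proof (rule clinear_on_span_zero[where g = "\<lambda>y. B (vac V) (I x r y)"])
    have "x \<in> carr M1" using x by (simp add: wt_space_def)
    then show "clinear_on (cvec.span (\<Union>n::nat. wt_space V M2 (of_nat n + h2))) (\<lambda>y. B (vac V) (I x r y))"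
      using lin intertwining_opD(1,2)[OF I] unfolding span2[symmetric] clinear_on_def by simp
  qed (use homogeneous x w span2 in auto)
  show ?thesis
  proof (rule clinear_on_span_zero[where g = "\<lambda>x. B (vac V) (I x r w2)"])
    show "clinear_on (cvec.span (\<Union>n::nat. wt_space V M1 (of_nat n + h1))) (\<lambda>x. B (vac V) (I x r w2))"
      using lin intertwining_opD(1,3)[OF I] w(2) unfolding span1[symmetric] clinear_on_def by simp
  qed (use right w span1 in auto)
qed

section \<open>Products of intertwining operators\<close>

locale intertwiner_chain =
  fixes V :: "'a::complex_vector voa"
    and B :: "'a \<Rightarrow> 'a \<Rightarrow> complex"
    and W :: "'i \<Rightarrow> 'a vmodule"
    and h :: "'i \<Rightarrow> complex"
    and o\<^sub>V :: 'i
    and \<Y> :: "'i \<Rightarrow> 'i \<Rightarrow> 'i \<Rightarrow> 'a \<Rightarrow> complex \<Rightarrow> 'a \<Rightarrow> 'a"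
    and n :: nat
    and \<alpha> \<beta> :: "nat \<Rightarrow> 'i"
  assumes voa: "is_voa V" and form: "invariant_form V B"
    and family: "irreducible_family V W h" and W_vac: "W o\<^sub>V = adjoint V"
    and intertwining: "\<And>\<alpha> \<beta> \<gamma>. intertwining_op V (W \<alpha>) (W \<beta>) (W \<gamma>) (\<Y> \<alpha> \<beta> \<gamma>)"
    and outer: "\<beta> 0 = o\<^sub>V" "\<beta> n = o\<^sub>V"
begin

definition admissible :: "(nat \<Rightarrow> 'a) \<Rightarrow> bool" where
  "admissible v \<longleftrightarrow> (\<forall>k\<in>{1..n}. v k \<in> carr (W (\<alpha> k)))"

text \<open>
  The coefficient of \<open>\<Y>(v\<^sub>s\<^sub>+\<^sub>1,y\<^sub>s\<^sub>+\<^sub>1) \<cdots> \<Y>(v\<^sub>n,y\<^sub>n)\<one>\<close>, a vector of the module labelled \<open>\<beta> s\<close>. Counting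
  the operators that are left out, rather than the first one present, makes \<open>s = n\<close> the vacuum and
  \<open>s = 0\<close> the full product, which suits downward induction on \<open>s\<close>.
\<close>

definition chain_after :: "nat \<Rightarrow> (nat \<Rightarrow> 'a) \<Rightarrow> (nat \<Rightarrow> complex) \<Rightarrow> 'a" where
  "chain_after s v e =
     foldr (\<lambda>k. \<Y> (\<alpha> k) (\<beta> k) (\<beta> (k - 1)) (v k) (- e k - 1)) [Suc s..<Suc n] (vac V)"

lemma weak: "weak_module V (W \<gamma>)"
  and W_span: "carr (W \<gamma>) = cvec.span (\<Union>m::nat. wt_space V (W \<gamma>) (of_nat m + h \<gamma>))"
  using family unfolding irreducible_family_def ordinary_module_def by blast+

lemma vac_carr: "vac V \<in> carr V" and vac_creation: "u \<in> carr V \<Longrightarrow> m \<ge> 0 \<Longrightarrow> mode V u m (vac V) = 0"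
  using voa by (auto simp: is_voa_def)

lemma subspace_W: "cvec.subspace (carr (W \<gamma>))"
  by (rule weak_moduleD(1)[OF weak])

lemma Y_carr: "w1 \<in> carr (W a) \<Longrightarrow> w2 \<in> carr (W b) \<Longrightarrow> \<Y> a b c w1 r w2 \<in> carr (W c)"
  by (rule intertwining_opD(1)[OF intertwining])

lemma Y_scale: "w1 \<in> carr (W a) \<Longrightarrow> w2 \<in> carr (W b) \<Longrightarrow> \<Y> a b c w1 r (z *\<^sub>C w2) = z *\<^sub>C \<Y> a b c w1 r w2"
  using intertwining_opD(2)[OF intertwining] by (simp add: clinear_on_def)

lemma Y_sum:
  "w1 \<in> carr (W a) \<Longrightarrow> (\<And>i. i \<in> I \<Longrightarrow> x i \<in> carr (W b)) \<Longrightarrow>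
    \<Y> a b c w1 r (\<Sum>i\<in>I. x i) = (\<Sum>i\<in>I. \<Y> a b c w1 r (x i))"
  by (rule clinear_on_sum[OF subspace_W intertwining_opD(2)[OF intertwining]])

lemma Y_zero: "w1 \<in> carr (W a) \<Longrightarrow> \<Y> a b c w1 r 0 = 0" "w2 \<in> carr (W b) \<Longrightarrow> \<Y> a b c 0 r w2 = 0"
  using clinear_on_zero[OF subspace_W intertwining_opD(2)[OF intertwining]]
    clinear_on_zero[OF subspace_W intertwining_opD(3)[OF intertwining]] by blast+

lemma B_linear: "clinear_on (carr V) (B (vac V))"
  using form vac_carr unfolding invariant_form_def by (blast intro: cbilinear_onD)

lemma B_scale: "x \<in> carr V \<Longrightarrow> B (vac V) (z *\<^sub>C x) = z * B (vac V) x"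
  using B_linear by (simp add: clinear_on_def scaleC_complex_def)

lemma B_add: "x \<in> carr V \<Longrightarrow> y \<in> carr V \<Longrightarrow> B (vac V) (x + y) = B (vac V) x + B (vac V) y"
  using B_linear by (simp add: clinear_on_def)

lemma subspace_V: "cvec.subspace (carr V)"
  using subspace_W[of o\<^sub>V] by (simp add: W_vac)

lemma B_sum: "(\<And>i. i \<in> I \<Longrightarrow> x i \<in> carr V) \<Longrightarrow> B (vac V) (\<Sum>i\<in>I. x i) = (\<Sum>i\<in>I. B (vac V) (x i))"
  by (rule clinear_on_sum[OF subspace_V B_linear])

lemma B_zero: "B (vac V) 0 = 0"
  by (rule clinear_on_zero[OF subspace_V B_linear])

lemma chain_after_n: "chain_after n v e = vac V"
  by (simp add: chain_after_def)

lemma chain_after_step: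
  "s < n \<Longrightarrow> chain_after s v e =
     \<Y> (\<alpha> (Suc s)) (\<beta> (Suc s)) (\<beta> s) (v (Suc s)) (- e (Suc s) - 1) (chain_after (Suc s) v e)"
  by (simp add: chain_after_def upt_conv_Cons[of "Suc s" "Suc n"] del: upt_Suc)

lemma chain_after_cong:
  assumes "\<And>k. s < k \<Longrightarrow> k \<le> n \<Longrightarrow> v k = v' k" and "\<And>k. s < k \<Longrightarrow> k \<le> n \<Longrightarrow> e k = e' k"
  shows "chain_after s v e = chain_after s v' e'"
  unfolding chain_after_def using assms by (intro foldr_cong) auto

lemma admissibleD: "admissible v \<Longrightarrow> s < n \<Longrightarrow> v (Suc s) \<in> carr (W (\<alpha> (Suc s)))"
  by (simp add: admissible_def)

lemma admissible_update: "admissible v \<Longrightarrow> x \<in> carr (W (\<alpha> k)) \<Longrightarrow> admissible (v(k := x))"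
  by (simp add: admissible_def)

lemma chain_after_carr:
  assumes "admissible v" and "s \<le> n"
  shows "chain_after s v e \<in> carr (W (\<beta> s))"
  using assms(2)
proof (induction rule: inc_induct)
  case base
  show ?case by (simp add: chain_after_n outer W_vac vac_carr)
next
  case (step s)
  then show ?case
    by (simp add: chain_after_step Y_carr admissibleD[OF assms(1)])
qed

lemma chain_after_zero:
  assumes "admissible v" and "v k = 0" and "s < k" and "k \<le> n"
  shows "chain_after s v e = 0"
proof -
  have "s \<le> k - 1" using assms(3) by simp
  then show ?thesis
  proof (induction rule: inc_induct)
    case base
    have "chain_after (k - 1) v e =
        \<Y> (\<alpha> k) (\<beta> k) (\<beta> (k - 1)) (v k) (- e k - 1) (chain_after k v e)"
      using chain_after_step[of "k - 1"] assms by simp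
    then show ?case
      using chain_after_carr[OF assms(1,4)] by (simp add: assms(2) Y_zero)
  next
    case (step s)
    then show ?case
      using assms by (simp add: chain_after_step Y_zero admissibleD)
  qed
qed

text \<open>
  Each operator passed contributes one commutator term, and at the right end \<open>u(m)\<close> annihilates the
  vacuum. The shift \<open>y\<^sub>k\<^bsup>m-j\<^esup>\<close> of the commutator formula appears as a shift of the exponent that is
  looked up.
\<close>

lemma mode_chain_after:
  assumes "admissible v" and u: "u \<in> carr V" and "s \<le> n"
  shows "mode (W (\<beta> s)) u (int m) (chain_after s v e) =
    (\<Sum>k=Suc s..n. \<Sum>j\<le>m. (of_nat m gchoose j) *\<^sub>C
       chain_after s (v(k := mode (W (\<alpha> k)) u (int j) (v k))) (e(k := e k - of_nat m + of_nat j)))"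
  using assms(3)
proof (induction rule: inc_induct)
  case base
  show ?case
    using vac_creation[OF u] by (simp add: chain_after_n outer W_vac)
next
  case (step s)
  have s: "s < n" using step by simp
  let ?Y = "\<Y> (\<alpha> (Suc s)) (\<beta> (Suc s)) (\<beta> s)" and ?r = "- e (Suc s) - 1"
  let ?v = "\<lambda>k j. v(k := mode (W (\<alpha> k)) u (int j) (v k))"
  let ?e = "\<lambda>k j. e(k := e k - of_nat m + of_nat j)"
  have w1: "v (Suc s) \<in> carr (W (\<alpha> (Suc s)))"
    by (rule admissibleD[OF assms(1) s])
  have adm: "admissible (?v k j)" if "k \<in> {1..n}" for k j
    using that assms(1) weak_moduleD(2)[OF weak u]
    by (intro admissible_update) (auto simp: admissible_def)
  have w2: "chain_after (Suc s) v e \<in> carr (W (\<beta> (Suc s)))"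
    by (rule chain_after_carr[OF assms(1)]) (use s in simp)
  have carr: "chain_after (Suc s) (?v k j) (?e k j) \<in> carr (W (\<beta> (Suc s)))"
    if "k \<in> {Suc (Suc s)..n}" for k j
    using that s by (intro chain_after_carr adm) auto
  have scaled: "z *\<^sub>C x \<in> carr (W \<gamma>)" if "x \<in> carr (W \<gamma>)" for z x \<gamma>
    using that subspace_W by (rule cvec.subspace_scale[rotated])
  have head: "chain_after s (?v (Suc s) j) (?e (Suc s) j)
      = ?Y (mode (W (\<alpha> (Suc s))) u (int j) (v (Suc s))) (?r + of_nat m - of_nat j) (chain_after (Suc s) v e)" for j
  proof -
    have "chain_after (Suc s) (?v (Suc s) j) (?e (Suc s) j) = chain_after (Suc s) v e"
      by (rule chain_after_cong) auto
    moreover have "- (e (Suc s) - of_nat m + of_nat j) - 1 = ?r + of_nat m - of_nat j"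
      by simp
    ultimately show ?thesis
      by (simp only: chain_after_step[OF s] fun_upd_same)
  qed
  have rest: "chain_after s (?v k j) (?e k j) = ?Y (v (Suc s)) ?r (chain_after (Suc s) (?v k j) (?e k j))"
    if "k \<in> {Suc (Suc s)..n}" for k j
    using that by (simp add: chain_after_step[OF s])
  have "mode (W (\<beta> s)) u (int m) (chain_after s v e) =
      (\<Sum>j\<le>m. (of_nat m gchoose j) *\<^sub>C chain_after s (?v (Suc s) j) (?e (Suc s) j)) +
      ?Y (v (Suc s)) ?r (mode (W (\<beta> (Suc s))) u (int m) (chain_after (Suc s) v e))"
    unfolding chain_after_step[OF s, of v e] head
    by (rule jacobi_commutator[OF intertwining_opD(5)[OF intertwining] u w1 w2])
  also have "?Y (v (Suc s)) ?r (mode (W (\<beta> (Suc s))) u (int m) (chain_after (Suc s) v e)) =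
      (\<Sum>k=Suc (Suc s)..n. ?Y (v (Suc s)) ?r
        (\<Sum>j\<le>m. (of_nat m gchoose j) *\<^sub>C chain_after (Suc s) (?v k j) (?e k j)))"
    unfolding step.IH
    by (intro Y_sum[OF w1] cvec.subspace_sum[OF subspace_W] scaled carr)
  also have "\<dots> = (\<Sum>k=Suc (Suc s)..n. \<Sum>j\<le>m.
      ?Y (v (Suc s)) ?r ((of_nat m gchoose j) *\<^sub>C chain_after (Suc s) (?v k j) (?e k j)))"
    by (intro sum.cong refl Y_sum[OF w1] scaled carr)
  also have "\<dots> = (\<Sum>k=Suc (Suc s)..n. \<Sum>j\<le>m. (of_nat m gchoose j) *\<^sub>C chain_after s (?v k j) (?e k j))"
    using rest by (intro sum.cong refl) (simp add: Y_scale[OF w1 carr])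
  also have "(\<Sum>j\<le>m. (of_nat m gchoose j) *\<^sub>C chain_after s (?v (Suc s) j) (?e (Suc s) j)) + \<dots>
      = (\<Sum>k=Suc s..n. \<Sum>j\<le>m. (of_nat m gchoose j) *\<^sub>C chain_after s (?v k j) (?e k j))"
    using s by (simp add: sum.atLeast_Suc_atMost[of "Suc s"])
  finally show ?case .
qed

definition supported :: "(nat \<Rightarrow> complex) \<Rightarrow> bool" where
  "supported e \<longleftrightarrow> (\<forall>k. k \<notin> {1..n} \<longrightarrow> e k = 0)"

lemma supported_update: "k \<in> {1..n} \<Longrightarrow> supported (e(k := x)) \<longleftrightarrow> supported e"
  by (auto simp: supported_def)

lemma Z0_chain_after:
  "Z0 V B \<Y> n \<alpha> \<beta> v e = (if supported e then B (vac V) (chain_after 0 v e) else 0)"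
  by (simp only: Z0_def supported_def chain_def chain_after_def One_nat_def)

end

section \<open>Ward identities and expansions\<close>

text \<open>
  The common truncation order \<open>J\<close> turns the sums over \<open>j \<ge> 0\<close> into finite sums whose range does not
  depend on \<open>k\<close>.
\<close>

locale genus_zero_ward = intertwiner_chain +
  fixes u :: 'a and N :: nat and v :: "nat \<Rightarrow> 'a" and J :: nat
  assumes n_pos: "n \<ge> 1" and quasi: "quasiprimary V N u" and adm: "admissible v"
    and J: "\<And>k j. k \<in> {1..n} \<Longrightarrow> j \<ge> J \<Longrightarrow> mode (W (\<alpha> k)) u (int j) (v k) = 0"
begin

definition v\<^sub>u :: "nat \<Rightarrow> nat \<Rightarrow> nat \<Rightarrow> 'a" where
  "v\<^sub>u k j = v(k := mode (W (\<alpha> k)) u (int j) (v k))"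

definition Z\<^sub>u :: "nat \<Rightarrow> nat \<Rightarrow> formal_series" where
  "Z\<^sub>u k j = Z0 V B \<Y> n \<alpha> \<beta> (v\<^sub>u k j)"

lemma u_carr: "u \<in> carr V"
  using quasi by (simp add: quasiprimary_def wt_space_def)

lemma mode_carr: "w \<in> carr (W \<gamma>) \<Longrightarrow> mode (W \<gamma>) u m w \<in> carr (W \<gamma>)"
  by (rule weak_moduleD(2)[OF weak u_carr])

lemma admissible_v\<^sub>u: "k \<in> {1..n} \<Longrightarrow> admissible (v\<^sub>u k j)"
  unfolding v\<^sub>u_def using adm by (intro admissible_update mode_carr) (auto simp: admissible_def)

lemma Z\<^sub>u_zero: "k \<in> {1..n} \<Longrightarrow> j \<ge> J \<Longrightarrow> Z\<^sub>u k j = 0"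
  using chain_after_zero[OF admissible_v\<^sub>u, of k j k 0]
  by (auto simp: Z\<^sub>u_def fun_eq_iff Z0_chain_after B_zero v\<^sub>u_def J)

lemma Z\<^sub>u_supported: "Z\<^sub>u k j e \<noteq> 0 \<Longrightarrow> supported e"
  by (auto simp: Z\<^sub>u_def Z0_chain_after split: if_splits)

text \<open>
  The left-hand side is the coefficient of \<open>\<Sum>\<^sub>k \<Sum>\<^sub>j binom(m,j) y\<^sub>k\<^bsup>m-j\<^esup> Z\<^sub>u k j\<close>. For \<open>m \<le> 2N-2\<close> it is the
  Ward identity for the monomial \<open>y\<^bsup>m\<^esup>\<close>; for larger \<open>m\<close> it is a coefficient of the function with
  \<open>Y(u,x)\<close> inserted.
\<close>

lemma vacuum_pairing_commutator:
  "(\<Sum>k=1..n. \<Sum>j<J. (of_nat m gchoose j) * Z\<^sub>u k j (e(k := e k - of_nat m + of_nat j))) =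
    (if supported e then B (vac V) (mode V u (int m) (chain_after 0 v e)) else 0)"
proof (cases "supported e")
  case True
  have carr: "chain_after 0 (v\<^sub>u k j) e' \<in> carr V" if "k \<in> {1..n}" for k j e'
    using chain_after_carr[OF admissible_v\<^sub>u[OF that], of 0] by (simp add: outer W_vac)
  have scaled: "z *\<^sub>C x \<in> carr V" if "x \<in> carr V" for z x
    using that subspace_V by (rule cvec.subspace_scale[rotated])
  have "mode V u (int m) (chain_after 0 v e) = (\<Sum>k=1..n. \<Sum>j\<le>m. (of_nat m gchoose j) *\<^sub>C
      chain_after 0 (v\<^sub>u k j) (e(k := e k - of_nat m + of_nat j)))"
    using mode_chain_after[OF adm u_carr, of 0 m e] by (simp add: outer W_vac v\<^sub>u_def)
  then have "B (vac V) (mode V u (int m) (chain_after 0 v e)) =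
      (\<Sum>k=1..n. B (vac V) (\<Sum>j\<le>m. (of_nat m gchoose j) *\<^sub>C
        chain_after 0 (v\<^sub>u k j) (e(k := e k - of_nat m + of_nat j))))"
    by (simp only:) (intro B_sum cvec.subspace_sum[OF subspace_V] scaled carr)
  also have "\<dots> = (\<Sum>k=1..n. \<Sum>j\<le>m. (of_nat m gchoose j) *
      Z\<^sub>u k j (e(k := e k - of_nat m + of_nat j)))"
  proof (rule sum.cong[OF refl])
    fix k assume k: "k \<in> {1..n}"
    have "B (vac V) (\<Sum>j\<le>m. (of_nat m gchoose j) *\<^sub>C
        chain_after 0 (v\<^sub>u k j) (e(k := e k - of_nat m + of_nat j))) =
      (\<Sum>j\<le>m. B (vac V) ((of_nat m gchoose j) *\<^sub>C
        chain_after 0 (v\<^sub>u k j) (e(k := e k - of_nat m + of_nat j))))"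
      by (intro B_sum scaled carr k)
    then show "B (vac V) (\<Sum>j\<le>m. (of_nat m gchoose j) *\<^sub>C
        chain_after 0 (v\<^sub>u k j) (e(k := e k - of_nat m + of_nat j))) =
      (\<Sum>j\<le>m. (of_nat m gchoose j) * Z\<^sub>u k j (e(k := e k - of_nat m + of_nat j)))"
      by (simp only: B_scale[OF carr[OF k]] Z\<^sub>u_def Z0_chain_after supported_update[OF k] True if_True)
  qed
  also have "\<dots> = (\<Sum>k=1..n. \<Sum>j<J. (of_nat m gchoose j) *
      Z\<^sub>u k j (e(k := e k - of_nat m + of_nat j)))"
    by (intro sum.cong refl sum_gbinomial_truncate) (simp add: Z\<^sub>u_zero)
  finally show ?thesis
    using True by simp
next
  case False
  then have "Z\<^sub>u k j (e(k := x)) = 0" if "k \<in> {1..n}" for k j x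
    using Z\<^sub>u_supported supported_update that by blast
  then show ?thesis
    unfolding if_not_P[OF False] by simp
qed

text \<open>
  The commutator formula evaluates \<open>\<langle>\<one>, u(l)P\<rangle>\<close>, while the adjoint of \<open>u(l)\<close> annihilates the vacuum.
\<close>

lemma ward_identity:
  assumes "l \<le> 2 * N - 2" and "N \<ge> 1"
  shows "(\<Sum>k=1..n. \<Sum>j<J. (of_nat l gchoose j) * Z\<^sub>u k j (e(k := e k - of_nat l + of_nat j))) = 0"
  unfolding vacuum_pairing_commutator
  using vacuum_pairing_quasiprimary_mode[OF voa form quasi, of "chain_after 0 v e" "int l"] assms
    chain_after_carr[OF adm, of 0 e]
  by (simp add: outer W_vac)

text \<open>
  By linearity in \<open>p\<close>, as \<open>binom(l,j) y\<^bsup>l-j\<^esup>\<close> is the \<open>j\<close>-th divided derivative of \<open>y\<^bsup>l\<^esup>\<close>.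
\<close>

lemma ward_polynomial:
  assumes "degree p \<le> 2 * N - 2" and "N \<ge> 1"
  shows "(\<Sum>k=1..n. \<Sum>j<J. Z\<^sub>u k j \<odot> divided_deriv k j (poly_in_var k p)) = 0"
proof
  fix e
  have "(\<Sum>k=1..n. \<Sum>j<J. Z\<^sub>u k j \<odot> divided_deriv k j (poly_in_var k p)) e =
      (\<Sum>k=1..n. \<Sum>j<J. \<Sum>l\<le>2*N-2. coeff p l * (of_nat l gchoose j)
        * Z\<^sub>u k j (e(k := e k - of_nat l + of_nat j)))"
    by (simp add: sum_fun_apply fs_mult_commute[of "Z\<^sub>u _ _"] poly_product_coeff[OF assms(1)])
  also have "\<dots> = (\<Sum>l\<le>2*N-2. coeff p l * (\<Sum>k=1..n. \<Sum>j<J. (of_nat l gchoose j)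
        * Z\<^sub>u k j (e(k := e k - of_nat l + of_nat j))))"
    by (subst sum_swap3) (simp add: sum_distrib_left mult.assoc)
  also have "\<dots> = 0"
    by (intro sum.neutral ballI) (simp only: atMost_iff ward_identity[OF _ assms(2)] mult_zero_right)
  finally show "(\<Sum>k=1..n. \<Sum>j<J. Z\<^sub>u k j \<odot> divided_deriv k j (poly_in_var k p)) e = 0 e"
    by simp
qed

text \<open>
  The coefficient of \<open>x\<^bsup>-m-1\<^esup>\<close> on the left is \<open>\<langle>\<one>, u(m)P\<rangle>\<close>: for \<open>m < 0\<close> it vanishes, and for \<open>m \<ge> 0\<close> the
  commutator formula identifies it with the coefficient from the polar part. The \<open>f\<^sub>l\<close>-part of the
  right-hand side is a combination of Ward identities.
\<close>

lemma insertion_expansion: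
  assumes "N \<ge> 1"
  shows "Z0_insert V B \<Y> n \<alpha> \<beta> u v = (\<Sum>k=1..n. \<Sum>j<J. pi_deriv N f 0 j 0 k \<odot> Z\<^sub>u k j)"
proof
  fix e :: "nat \<Rightarrow> complex"
  \<comment> \<open>A term survives only if its kernel uses up the whole exponent of \<open>x\<close>: this leaves
    \<open>m = - e 0 - 1\<close> in the polar part and \<open>s = e 0\<close> in the \<open>f\<^sub>l\<close>-part, and nothing when \<open>e 0\<close> is not
    an integer.\<close>
  define M where "M = (if e 0 \<in> \<int> then nat (- \<lfloor>Re (e 0)\<rfloor>) else 0)"
  define R where "R = (if e 0 \<in> \<int> then {\<lfloor>Re (e 0)\<rfloor>} else {})"
  define G where "G m e = (\<Sum>k=1..n. \<Sum>j<J. (of_nat m gchoose j) * Z\<^sub>u k j (e(k := e k - of_nat m + of_nat j)))"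
    for m e
  have expand: "(pi_deriv N f 0 j 0 k \<odot> Z\<^sub>u k j) e =
      (\<Sum>m<M. (of_nat m gchoose j) * Z\<^sub>u k j (e(0 := e 0 + of_nat m + 1, k := e k - of_nat m + of_nat j))) +
      (\<Sum>l=0..2*N-2. \<Sum>s\<in>R. fls_nth (f l) s * ((of_nat l gchoose j)
        * Z\<^sub>u k j (e(0 := e 0 - of_int s, k := e k - of_nat l + of_nat j))))"
    if k: "k \<in> {1..n}" for k j
  proof -
    have zero: "Z\<^sub>u k j (e(0 := x, k := y)) = 0" if "x \<noteq> 0" for x y
    proof (rule ccontr)
      assume "Z\<^sub>u k j (e(0 := x, k := y)) \<noteq> 0"
      then have "(e(0 := x, k := y)) 0 = 0"
        using Z\<^sub>u_supported unfolding supported_def by (metis atLeastAtMost_iff not_one_le_zero)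
      then show False using that k by simp
    qed
    have M: "e 0 + of_nat m + 1 \<noteq> 0" if "m \<ge> M" for m
    proof
      assume "e 0 + of_nat m + 1 = 0"
      then have "e 0 = - (of_nat m + 1)"
        by (simp only: eq_neg_iff_add_eq_0 add.assoc)
      then have "e 0 = of_int (- int m - 1)"
        by simp
      then show False
        using that by (simp add: M_def del: of_int_diff of_int_minus)
    qed
    have R: "e 0 - of_int s \<noteq> 0" if "s \<notin> R" for s
      using that by (auto simp: R_def)
    have "(pi_deriv N f 0 j 0 k \<odot> Z\<^sub>u k j) e =
      (\<Sum>m<M. ((- of_nat m - 1) gchoose 0) * (of_nat m gchoose j)
        * Z\<^sub>u k j (e(0 := e 0 + of_nat m + 1 + of_nat 0, k := e k - of_nat m + of_nat j))) +
      (\<Sum>l=0..2*N-2. \<Sum>s\<in>R. ((of_int s + of_nat 0) gchoose 0) * fls_nth (f l) (s + int 0) * (of_nat l gchoose j)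
          * Z\<^sub>u k j (e(0 := e 0 - of_int s, k := e k - of_nat l + of_nat j)))"
    proof (rule pi_deriv_product_coeff)
      show "0 \<noteq> k" using k by simp
      show "finite R" by (simp add: R_def)
      show "Z\<^sub>u k j (e(0 := e 0 + of_nat m + 1 + of_nat 0, k := e k - of_nat m + of_nat j)) = 0"
        if "m \<ge> M" for m
        using M[OF that] by (simp add: zero)
      show "fls_nth (f l) (s + int 0) * Z\<^sub>u k j (e(0 := e 0 - of_int s, k := e k - of_nat l + of_nat j)) = 0"
        if "s \<notin> R" for l s
        using zero[OF R[OF that]] by simp
    qed
    then show ?thesis
      by (simp add: mult.assoc)
  qed
  have "(\<Sum>k=1..n. \<Sum>j<J. pi_deriv N f 0 j 0 k \<odot> Z\<^sub>u k j) e =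
      (\<Sum>k=1..n. \<Sum>j<J. (\<Sum>m<M. (of_nat m gchoose j) * Z\<^sub>u k j (e(0 := e 0 + of_nat m + 1, k := e k - of_nat m + of_nat j)))) +
      (\<Sum>k=1..n. \<Sum>j<J. (\<Sum>l=0..2*N-2. \<Sum>s\<in>R. fls_nth (f l) s * ((of_nat l gchoose j)
        * Z\<^sub>u k j (e(0 := e 0 - of_int s, k := e k - of_nat l + of_nat j)))))"
    unfolding sum_fun_apply sum.distrib[symmetric] by (intro sum.cong refl expand)
  also have "(\<Sum>k=1..n. \<Sum>j<J. (\<Sum>l=0..2*N-2. \<Sum>s\<in>R. fls_nth (f l) s * ((of_nat l gchoose j)
        * Z\<^sub>u k j (e(0 := e 0 - of_int s, k := e k - of_nat l + of_nat j))))) =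
      (\<Sum>l=0..2*N-2. \<Sum>s\<in>R. fls_nth (f l) s * G l (e(0 := e 0 - of_int s)))"
    unfolding sum_swap4[where A = "{0..2*N-2}"] G_def sum_distrib_left by (intro sum.cong refl) auto
  also have "\<dots> = 0"
  proof -
    have "G l e' = 0" if "l \<in> {0..2*N-2}" for l e'
      unfolding G_def by (rule ward_identity[OF _ assms]) (use that in simp)
    then show ?thesis by simp
  qed
  also have "(\<Sum>k=1..n. \<Sum>j<J. (\<Sum>m<M. (of_nat m gchoose j) * Z\<^sub>u k j (e(0 := e 0 + of_nat m + 1, k := e k - of_nat m + of_nat j))))
      = (\<Sum>m<M. G m (e(0 := e 0 + of_nat m + 1)))"
    unfolding sum_swap3[where A = "{..<M}"] G_def by (intro sum.cong refl) auto
  also have "\<dots> = Z0_insert V B \<Y> n \<alpha> \<beta> u v e"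
  proof (cases "(\<forall>k. k \<notin> {0..n} \<longrightarrow> e k = 0) \<and> e 0 \<in> \<int>")
    case True
    then obtain z where z: "e 0 = of_int z"
      by (auto elim: Ints_cases)
    have chain_eq: "chain_after 0 v (e(0 := x)) = chain_after 0 v e" for x
      by (rule chain_after_cong) auto
    have carr: "chain_after 0 v e \<in> carr V"
      using chain_after_carr[OF adm, of 0 e] by (simp add: outer W_vac)
    have supp: "supported (e(0 := x)) \<longleftrightarrow> x = 0" for x
    proof
      assume "supported (e(0 := x))"
      then have "(e(0 := x)) 0 = 0"
        unfolding supported_def by (metis atLeastAtMost_iff not_one_le_zero)
      then show "x = 0" by simp
    qed (use True in \<open>auto simp: supported_def Suc_le_eq\<close>)
    have G: "G m (e(0 := e 0 + of_nat m + 1)) =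
        (if m = nat (- z - 1) \<and> z < 0 then B (vac V) (mode V u (- z - 1) (chain_after 0 v e)) else 0)" for m
    proof -
      have "e 0 + of_nat m + 1 = 0 \<longleftrightarrow> of_int (z + int m + 1) = (0 :: complex)"
        by (simp add: z)
      also have "\<dots> \<longleftrightarrow> m = nat (- z - 1) \<and> z < 0"
        unfolding of_int_eq_0_iff by auto
      finally show ?thesis
        unfolding G_def vacuum_pairing_commutator supp chain_eq by auto
    qed
    have "Z0_insert V B \<Y> n \<alpha> \<beta> u v e = B (vac V) (mode V u (- z - 1) (chain_after 0 v e))"
    proof -
      have "- e 0 - 1 = of_int (- z - 1)" by (simp add: z)
      then have "complex_modes (adjoint V) u (- e 0 - 1) w = mode V u (- z - 1) w" for w
        by (simp add: complex_modes_def del: of_int_diff of_int_minus)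
      moreover have "chain V \<Y> n \<alpha> \<beta> v e = chain_after 0 v e"
        by (simp only: chain_def chain_after_def One_nat_def)
      ultimately show ?thesis
        using True by (simp add: Z0_insert_def)
    qed
    also have "\<dots> = (\<Sum>m<M. G m (e(0 := e 0 + of_nat m + 1)))"
    proof (cases "z < 0")
      case True
      then have "nat (- z - 1) < M"
        by (simp add: M_def z)
      then show ?thesis
        using True by (simp add: G sum.delta)
    next
      case False
      then show ?thesis
        using vacuum_pairing_quasiprimary_mode[OF voa form quasi carr, of "- z - 1"] assms
        by (simp add: G)
    qed
    finally show ?thesis by simp
  next
    case False
    have "G m (e(0 := e 0 + of_nat m + 1)) = 0" if "m < M" for m
    proof -
      have "e 0 \<in> \<int>"
        using that by (auto simp: M_def split: if_splits)
      with False obtain k where k: "k \<notin> {0..n}" "e k \<noteq> 0" by blast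
      then have "k \<notin> {1..n}" "(e(0 := e 0 + of_nat m + 1)) k \<noteq> 0" by auto
      then show ?thesis
        unfolding G_def vacuum_pairing_commutator supported_def by metis
    qed
    moreover have "Z0_insert V B \<Y> n \<alpha> \<beta> u v e = 0"
    proof -
      have "- e 0 - 1 \<in> \<int> \<longleftrightarrow> e 0 \<in> \<int>"
        by (metis Ints_1 Ints_add Ints_diff Ints_minus add.inverse_inverse diff_add_cancel)
      with False show ?thesis
        by (auto simp: Z0_insert_def complex_modes_def B_zero)
    qed
    ultimately show ?thesis by simp
  qed
  finally show "Z0_insert V B \<Y> n \<alpha> \<beta> u v e = (\<Sum>k=1..n. \<Sum>j<J. pi_deriv N f 0 j 0 k \<odot> Z\<^sub>u k j) e"
    by simp
qed

lemma chain_first: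
  "chain_after 0 v' e = \<Y> (\<alpha> 1) (\<beta> 1) o\<^sub>V (v' 1) (- e 1 - 1) (chain_after 1 v' e)"
  using chain_after_step[of 0] n_pos by (simp add: outer)

lemma first_pairing_bounded:
  assumes "w1 \<in> carr (W (\<alpha> 1))" and "w2 \<in> carr (W (\<beta> 1))"
    and "Re r < Re (h (\<alpha> 1)) + Re (h (\<beta> 1)) - 1"
  shows "B (vac V) (\<Y> (\<alpha> 1) (\<beta> 1) o\<^sub>V w1 r w2) = 0"
  using vacuum_pairing_intertwining_bounded[OF voa form
      intertwining[of "\<alpha> 1" "\<beta> 1" o\<^sub>V, unfolded W_vac] W_span W_span assms] .

text \<open>
  Increasing \<open>s\<close> lowers the exponent of \<open>y\<^sub>1\<close>, so this bounds that exponent from below, for a fixed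
  vector \<open>w\<^sub>2\<close>.
\<close>

lemma first_pairing_truncated:
  assumes "w1 \<in> carr (W (\<alpha> 1))" and "w2 \<in> carr (W (\<beta> 1))"
  shows "eventually (\<lambda>s::int. B (vac V) (\<Y> (\<alpha> 1) (\<beta> 1) o\<^sub>V w1 (r + of_int s) w2) = 0) at_top"
  using truncated_eventually[OF intertwining_opD(4)[OF intertwining[of "\<alpha> 1" "\<beta> 1" o\<^sub>V]] assms, of r]
  by (rule eventually_mono) (simp add: B_zero)

lemma Z\<^sub>u_first:
  "Z\<^sub>u 1 j (e(1 := x)) = (if supported e then
     B (vac V) (\<Y> (\<alpha> 1) (\<beta> 1) o\<^sub>V (mode (W (\<alpha> 1)) u (int j) (v 1)) (- x - 1) (chain_after 1 v e)) else 0)"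
proof -
  have "chain_after 1 (v\<^sub>u 1 j) (e(1 := x)) = chain_after 1 v e"
    by (rule chain_after_cong) (auto simp: v\<^sub>u_def)
  moreover have "1 \<in> {1..n}" using n_pos by simp
  ultimately show ?thesis
    by (simp only: Z\<^sub>u_def Z0_chain_after chain_first supported_update fun_upd_same)
      (simp add: v\<^sub>u_def)
qed

lemma Z\<^sub>u_later:
  assumes "k \<in> {2..n}"
  shows "Z\<^sub>u k j (e(1 := x, k := y)) = (if supported e then
     B (vac V) (\<Y> (\<alpha> 1) (\<beta> 1) o\<^sub>V (v 1) (- x - 1) (chain_after 1 (v\<^sub>u k j) (e(k := y)))) else 0)"
proof -
  have "chain_after 1 (v\<^sub>u k j) (e(1 := x, k := y)) = chain_after 1 (v\<^sub>u k j) (e(k := y))"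
    by (rule chain_after_cong) auto
  moreover have "1 \<in> {1..n}" "k \<in> {1..n}" "1 \<noteq> k" using n_pos assms by auto
  moreover have "v\<^sub>u k j 1 = v 1"
    using assms by (simp add: v\<^sub>u_def)
  ultimately show ?thesis
    by (simp only: Z\<^sub>u_def Z0_chain_after chain_first supported_update fun_upd_same
        fun_upd_other[OF \<open>1 \<noteq> k\<close>])
qed

text \<open>
  The commutator formula applied behind the first operator, hence without the term \<open>k = 1\<close>.
\<close>

lemma first_insertion_pairing:
  assumes "supported e"
  shows "B (vac V) (\<Y> (\<alpha> 1) (\<beta> 1) o\<^sub>V (v 1) (- x - 1) (mode (W (\<beta> 1)) u (int m) (chain_after 1 v e))) =
    (\<Sum>k=2..n. \<Sum>j<J. (of_nat m gchoose j) * Z\<^sub>u k j (e(1 := x, k := e k - of_nat m + of_nat j)))"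
proof -
  let ?Y = "\<Y> (\<alpha> 1) (\<beta> 1) o\<^sub>V (v 1) (- x - 1)"
  let ?c = "\<lambda>k j. chain_after 1 (v\<^sub>u k j) (e(k := e k - of_nat m + of_nat j))"
  have v1: "v 1 \<in> carr (W (\<alpha> 1))"
    using adm n_pos by (simp add: admissible_def)
  have carr: "?c k j \<in> carr (W (\<beta> 1))" if "k \<in> {2..n}" for k j
    using that n_pos by (intro chain_after_carr admissible_v\<^sub>u) auto
  have carrY: "?Y w \<in> carr V" if "w \<in> carr (W (\<beta> 1))" for w
    using Y_carr[OF v1 that, of o\<^sub>V] by (simp add: W_vac)
  have scaled: "z *\<^sub>C w \<in> carr (W \<gamma>)" if "w \<in> carr (W \<gamma>)" for z w \<gamma>
    using that subspace_W by (rule cvec.subspace_scale[rotated])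
  have inner: "(\<Sum>j\<le>m. (of_nat m gchoose j) *\<^sub>C ?c k j) \<in> carr (W (\<beta> 1))" if "k \<in> {2..n}" for k
    by (intro cvec.subspace_sum[OF subspace_W] scaled carr that)
  have "mode (W (\<beta> 1)) u (int m) (chain_after 1 v e) =
      (\<Sum>k=2..n. \<Sum>j\<le>m. (of_nat m gchoose j) *\<^sub>C ?c k j)"
    using mode_chain_after[OF adm u_carr n_pos] by (simp add: v\<^sub>u_def numeral_2_eq_2)
  then have "B (vac V) (?Y (mode (W (\<beta> 1)) u (int m) (chain_after 1 v e))) =
      B (vac V) (\<Sum>k=2..n. ?Y (\<Sum>j\<le>m. (of_nat m gchoose j) *\<^sub>C ?c k j))"
    using Y_sum[OF v1 inner, of "{2..n}" "\<lambda>k. k"] by simp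
  also have "\<dots> = (\<Sum>k=2..n. B (vac V) (?Y (\<Sum>j\<le>m. (of_nat m gchoose j) *\<^sub>C ?c k j)))"
    by (intro B_sum carrY inner)
  also have "\<dots> = (\<Sum>k=2..n. \<Sum>j<J. (of_nat m gchoose j) * Z\<^sub>u k j (e(1 := x, k := e k - of_nat m + of_nat j)))"
  proof (rule sum.cong[OF refl])
    fix k assume k: "k \<in> {2..n}"
    have "?Y (\<Sum>j\<le>m. (of_nat m gchoose j) *\<^sub>C ?c k j) = (\<Sum>j\<le>m. (of_nat m gchoose j) *\<^sub>C ?Y (?c k j))"
      by (subst Y_sum[OF v1]) (simp_all only: scaled[OF carr[OF k]] Y_scale[OF v1 carr[OF k]])
    moreover have "B (vac V) (\<Sum>j\<le>m. (of_nat m gchoose j) *\<^sub>C ?Y (?c k j)) =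
        (\<Sum>j\<le>m. B (vac V) ((of_nat m gchoose j) *\<^sub>C ?Y (?c k j)))"
      by (rule B_sum) (rule cvec.subspace_scale[OF subspace_V carrY[OF carr[OF k]]])
    ultimately have "B (vac V) (?Y (\<Sum>j\<le>m. (of_nat m gchoose j) *\<^sub>C ?c k j)) =
        (\<Sum>j\<le>m. (of_nat m gchoose j) * Z\<^sub>u k j (e(1 := x, k := e k - of_nat m + of_nat j)))"
      using assms by (simp only: Z\<^sub>u_later[OF k] if_True B_scale[OF carrY[OF carr[OF k]]])
    then show "B (vac V) (?Y (\<Sum>j\<le>m. (of_nat m gchoose j) *\<^sub>C ?c k j)) =
        (\<Sum>j<J. (of_nat m gchoose j) * Z\<^sub>u k j (e(1 := x, k := e k - of_nat m + of_nat j)))"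
      using k by (simp add: sum_gbinomial_truncate Z\<^sub>u_zero)
  qed
  finally show ?thesis .
qed

text \<open>
  After the iterate formula, the terms with a negative mode of \<open>u\<close> to the left of \<open>\<Y>(v\<^sub>1,y\<^sub>1)\<close> pair to
  zero with the vacuum. The remaining ones carry \<open>u(m)\<close>, \<open>m \<ge> 0\<close>, directly behind \<open>\<Y>(v\<^sub>1,y\<^sub>1)\<close>.
\<close>

lemma first_negative_mode:
  assumes "N \<ge> 1" and M: "\<And>m. m \<ge> M \<Longrightarrow> mode (W (\<beta> 1)) u (int m) (chain_after 1 v e) = 0"
  shows "Z0 V B \<Y> n \<alpha> \<beta> (v(1 := mode (W (\<alpha> 1)) u (- int i - 1) (v 1))) e =
    (\<Sum>m<M. ((- of_nat m - 1) gchoose i) * (\<Sum>k=2..n. \<Sum>j<J. (of_nat m gchoose j)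
      * Z\<^sub>u k j (e(1 := e 1 + of_nat m + 1 + of_nat i, k := e k - of_nat m + of_nat j))))"
proof (cases "supported e")
  case True
  let ?Y = "\<Y> (\<alpha> 1) (\<beta> 1) o\<^sub>V (v 1)" and ?w = "chain_after 1 v e" and ?r = "- e 1 - 1"
  have v1: "v 1 \<in> carr (W (\<alpha> 1))"
    using adm n_pos by (simp add: admissible_def)
  have w: "?w \<in> carr (W (\<beta> 1))"
    by (rule chain_after_carr[OF adm n_pos])
  obtain K where K: "\<And>j. j \<ge> K \<Longrightarrow> ?Y (?r + of_nat j) ?w = 0"
    using intertwining_opD(4)[OF intertwining] v1 w unfolding truncated_def by blast
  have carrY: "?Y r x \<in> carr V" if "x \<in> carr (W (\<beta> 1))" for r x
    using Y_carr[OF v1 that, of o\<^sub>V] by (simp add: W_vac)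
  have carr_mode: "mode V u m x \<in> carr V" if "x \<in> carr V" for m x
    using mode_carr[of x o\<^sub>V] that by (simp add: W_vac)
  note scaled = cvec.subspace_scale[OF subspace_V]
  let ?P = "\<Sum>j<K. ((-1) ^ j * ((- of_nat i - 1) gchoose j)) *\<^sub>C
      mode V u (- int i - 1 - int j) (?Y (?r + of_nat j) ?w)"
  let ?Q = "\<Sum>m<M. ((- of_nat m - 1) gchoose i) *\<^sub>C
      ?Y (?r - of_nat m - 1 - of_nat i) (mode (W (\<beta> 1)) u (int m) ?w)"
  have "chain_after 1 (v(1 := mode (W (\<alpha> 1)) u (- int i - 1) (v 1))) e = ?w"
    by (rule chain_after_cong) auto
  then have "Z0 V B \<Y> n \<alpha> \<beta> (v(1 := mode (W (\<alpha> 1)) u (- int i - 1) (v 1))) e =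
      B (vac V) (\<Y> (\<alpha> 1) (\<beta> 1) o\<^sub>V (mode (W (\<alpha> 1)) u (- int i - 1) (v 1)) ?r ?w)"
    using True by (simp add: Z0_chain_after chain_first supported_def)
  also have "\<Y> (\<alpha> 1) (\<beta> 1) o\<^sub>V (mode (W (\<alpha> 1)) u (- int i - 1) (v 1)) ?r ?w = ?P + ?Q"
    using jacobi_iterate[OF intertwining[of "\<alpha> 1" "\<beta> 1" o\<^sub>V] weak weak u_carr v1 w K M]
    by (simp add: W_vac)
  also have "B (vac V) (?P + ?Q) = B (vac V) ?P + B (vac V) ?Q"
    by (intro B_add cvec.subspace_sum[OF subspace_V] scaled carr_mode carrY w mode_carr)
  also have "B (vac V) ?P = 0"
  proof -
    have "B (vac V) (mode V u (- int i - 1 - int j) (?Y (?r + of_nat j) ?w)) = 0" for j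
      by (rule vacuum_pairing_quasiprimary_mode[OF voa form quasi carrY[OF w]]) (use assms(1) in simp)
    moreover have carr: "mode V u (- int i - 1 - int j) (?Y (?r + of_nat j) ?w) \<in> carr V" for j
      by (intro carr_mode carrY w)
    moreover have "B (vac V) ?P = (\<Sum>j<K. B (vac V) (((-1) ^ j * ((- of_nat i - 1) gchoose j)) *\<^sub>C
        mode V u (- int i - 1 - int j) (?Y (?r + of_nat j) ?w)))"
      by (intro B_sum scaled carr)
    ultimately show ?thesis
      by (simp only: B_scale mult_zero_right sum.neutral_const)
  qed
  also have "B (vac V) ?Q = (\<Sum>m<M. ((- of_nat m - 1) gchoose i) *
      B (vac V) (?Y (?r - of_nat m - 1 - of_nat i) (mode (W (\<beta> 1)) u (int m) ?w)))"
  proof -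
    have carr: "?Y r (mode (W (\<beta> 1)) u m ?w) \<in> carr V" for r m
      by (intro carrY mode_carr w)
    have "B (vac V) ?Q = (\<Sum>m<M. B (vac V) (((- of_nat m - 1) gchoose i) *\<^sub>C
        ?Y (?r - of_nat m - 1 - of_nat i) (mode (W (\<beta> 1)) u (int m) ?w)))"
      by (intro B_sum scaled carr)
    then show ?thesis
      by (simp only: B_scale[OF carr])
  qed
  also have "\<dots> = (\<Sum>m<M. ((- of_nat m - 1) gchoose i) * (\<Sum>k=2..n. \<Sum>j<J. (of_nat m gchoose j)
      * Z\<^sub>u k j (e(1 := e 1 + of_nat m + 1 + of_nat i, k := e k - of_nat m + of_nat j))))"
  proof (intro sum.cong refl arg_cong2[where f = "(*)"])
    fix m
    have "?r - of_nat m - 1 - of_nat i = - (e 1 + of_nat m + 1 + of_nat i) - 1"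
      by simp
    then show "B (vac V) (?Y (?r - of_nat m - 1 - of_nat i) (mode (W (\<beta> 1)) u (int m) ?w)) =
        (\<Sum>k=2..n. \<Sum>j<J. (of_nat m gchoose j)
          * Z\<^sub>u k j (e(1 := e 1 + of_nat m + 1 + of_nat i, k := e k - of_nat m + of_nat j)))"
      by (simp only: first_insertion_pairing[OF True])
  qed
  finally show ?thesis by (simp only: add_0)
next
  case False
  then have "Z0 V B \<Y> n \<alpha> \<beta> (v(1 := mode (W (\<alpha> 1)) u (- int i - 1) (v 1))) e = 0"
    by (simp only: Z0_chain_after supported_def if_False)
  moreover have "Z\<^sub>u k j (e(1 := x, k := y)) = 0" if "k \<in> {2..n}" for k j x y
    using False by (simp only: Z\<^sub>u_later[OF that] if_False)
  ultimately show ?thesis by simp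
qed

text \<open>
  Both bounds concern the same index \<open>m\<close>: truncation of \<open>u(m)\<close> ends the sum of the iterate formula, and
  the weight bound ends the expansion of the polar part of \<open>\<pi>\<^sub>N(y\<^sub>1,y\<^sub>k)\<close>, where \<open>m\<close> raises the exponent of \<open>y\<^sub>1\<close>.
\<close>

lemma first_mode_bounds:
  obtains M :: nat where
    "\<And>m. m \<ge> M \<Longrightarrow> mode (W (\<beta> 1)) u (int m) (chain_after 1 v e) = 0"
    "\<And>k j m y. k \<in> {2..n} \<Longrightarrow> m \<ge> M \<Longrightarrow> Z\<^sub>u k j (e(1 := e 1 + of_nat m + 1 + of_nat i, k := y)) = 0"
proof -
  obtain M1 where M1: "\<And>m. m \<ge> M1 \<Longrightarrow> mode (W (\<beta> 1)) u (int m) (chain_after 1 v e) = 0"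
    using truncated_mode[OF weak u_carr chain_after_carr[OF adm n_pos]] by blast
  obtain M2 :: nat where M2: "real M2 > - Re (e 1) - 1 - real i - Re (h (\<alpha> 1)) - Re (h (\<beta> 1))"
    using reals_Archimedean2 by blast
  have "Z\<^sub>u k j (e(1 := e 1 + of_nat m + 1 + of_nat i, k := y)) = 0"
    if k: "k \<in> {2..n}" and m: "m \<ge> M2" for k j m y
  proof -
    have "real m \<ge> real M2" using m by simp
    then have "Re (- (e 1 + of_nat m + 1 + of_nat i) - 1) < Re (h (\<alpha> 1)) + Re (h (\<beta> 1)) - 1"
      using M2 by simp
    moreover have "v 1 \<in> carr (W (\<alpha> 1))"
      using adm n_pos by (simp add: admissible_def)
    moreover have "chain_after 1 (v\<^sub>u k j) (e(k := y)) \<in> carr (W (\<beta> 1))"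
      using k n_pos by (intro chain_after_carr admissible_v\<^sub>u) auto
    ultimately show ?thesis
      by (simp only: Z\<^sub>u_later[OF k] first_pairing_bounded if_cancel)
  qed
  then show ?thesis
    using that[of "max M1 M2"] M1 by simp
qed

text \<open>
  The exponent \<open>s\<close> of \<open>y\<^sub>1\<close> in \<open>f\<^sub>l\<^bsup>(i)\<^esup>(y\<^sub>1)\<close> is bounded below because \<open>f\<^sub>l\<close> is a Laurent series. It is bounded
  above because the exponents of the other variables take only finitely many values here, so that
  truncation of \<open>\<Y>(v\<^sub>1,y\<^sub>1)\<close> acts on finitely many vectors.
\<close>

lemma kernel_exponent_range:
  fixes f :: "nat \<Rightarrow> complex fls"
  obtains R :: "int set" where "finite R"
    "\<And>k j l s. k \<in> {1..n} \<Longrightarrow> j < J \<Longrightarrow> l \<le> L \<Longrightarrow> s \<notin> R \<Longrightarrow> fls_nth (f l) (s + int i) *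
       Z\<^sub>u k j ((e(1 := e 1 - of_int s))(k := (e(1 := e 1 - of_int s)) k - of_nat l + of_nat j)) = 0"
proof -
  let ?Z = "\<lambda>k j l s. Z\<^sub>u k j ((e(1 := e 1 - of_int s))(k := (e(1 := e 1 - of_int s)) k - of_nat l + of_nat j))"
  have v1: "v 1 \<in> carr (W (\<alpha> 1))"
    using adm n_pos by (simp add: admissible_def)
  have "eventually (\<lambda>s. ?Z k j l s = 0) at_top" if k: "k \<in> {1..n}" for k j l
  proof (cases "k = 1")
    case True
    let ?w = "mode (W (\<alpha> 1)) u (int j) (v 1)"
    have eq: "?Z 1 j l s = (if supported e then B (vac V)
        (\<Y> (\<alpha> 1) (\<beta> 1) o\<^sub>V ?w (- e 1 + of_nat l - of_nat j - 1 + of_int s) (chain_after 1 v e)) else 0)" for s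
    proof -
      have "- (e 1 - of_int s - of_nat l + of_nat j) - 1 = - e 1 + of_nat l - of_nat j - 1 + of_int s"
        by simp
      then show ?thesis
        by (simp only: fun_upd_upd fun_upd_same Z\<^sub>u_first)
    qed
    have "eventually (\<lambda>s. B (vac V) (\<Y> (\<alpha> 1) (\<beta> 1) o\<^sub>V ?w
        (- e 1 + of_nat l - of_nat j - 1 + of_int s) (chain_after 1 v e)) = 0) at_top"
      by (intro first_pairing_truncated mode_carr v1 chain_after_carr adm n_pos)
    then show ?thesis
      unfolding True eq by (rule eventually_mono) simp
  next
    case False
    with k have k2: "k \<in> {2..n}" by auto
    let ?c = "chain_after 1 (v\<^sub>u k j) (e(k := e k - of_nat l + of_nat j))"
    have eq: "?Z k j l s = (if supported e then B (vac V)
        (\<Y> (\<alpha> 1) (\<beta> 1) o\<^sub>V (v 1) (- e 1 - 1 + of_int s) ?c) else 0)" for s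
    proof -
      have "- (e 1 - of_int s) - 1 = - e 1 - 1 + of_int s" by simp
      then show ?thesis
        by (simp only: fun_upd_other[OF False] Z\<^sub>u_later[OF k2])
    qed
    have "eventually (\<lambda>s. B (vac V) (\<Y> (\<alpha> 1) (\<beta> 1) o\<^sub>V (v 1) (- e 1 - 1 + of_int s) ?c) = 0) at_top"
      by (intro first_pairing_truncated v1 chain_after_carr admissible_v\<^sub>u k n_pos)
    then show ?thesis
      unfolding eq by (rule eventually_mono) simp
  qed
  then have "eventually (\<lambda>s. \<forall>k\<in>{1..n}. \<forall>j\<in>{..<J}. \<forall>l\<in>{..L}. ?Z k j l s = 0) at_top"
    by (simp add: eventually_ball_finite)
  then obtain S where S: "\<And>s. s \<ge> S \<Longrightarrow> \<forall>k\<in>{1..n}. \<forall>j\<in>{..<J}. \<forall>l\<in>{..L}. ?Z k j l s = 0"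
    unfolding eventually_at_top_linorder by blast
  have "eventually (\<lambda>s. fls_nth (f l) (s + int i) = 0) at_bot" for l
    unfolding eventually_at_bot_dense
    by (rule exI[of _ "fls_subdegree (f l) - int i"]) simp
  then have "eventually (\<lambda>s. \<forall>l\<in>{..L}. fls_nth (f l) (s + int i) = 0) at_bot"
    by (simp add: eventually_ball_finite)
  then obtain A where A: "\<And>s. s \<le> A \<Longrightarrow> \<forall>l\<in>{..L}. fls_nth (f l) (s + int i) = 0"
    unfolding eventually_at_bot_linorder by blast
  show ?thesis
  proof (rule that)
    show "finite {A..S}" by simp
    fix k j l s assume "k \<in> {1..n}" "j < J" "l \<le> L" "s \<notin> {A..S}"
    then show "fls_nth (f l) (s + int i) * ?Z k j l s = 0"
      using S[of s] A[of s] by (cases "s \<le> A") (auto simp del: fun_upd_apply)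
  qed
qed

text \<open>
  The polar parts at \<open>y\<^sub>2, \<dots>, y\<^sub>n\<close> reproduce the left-hand side. The \<open>f\<^sub>l\<close>-terms with \<open>k \<ge> 2\<close> lack exactly the
  term \<open>k = 1\<close> of the Ward identity for \<open>y\<^bsup>l\<^esup>\<close>, and \<open>e\<^sub>i\<^bsup>j\<^esup>(y\<^sub>1)\<close> supplies it; together they vanish.
\<close>

lemma first_mode_expansion:
  assumes "N \<ge> 1"
  shows "Z0 V B \<Y> n \<alpha> \<beta> (v(1 := mode (W (\<alpha> 1)) u (- int i - 1) (v 1))) =
    (\<Sum>j<J. e_series N f i j 1 \<odot> Z\<^sub>u 1 j) + (\<Sum>k=2..n. \<Sum>j<J. pi_deriv N f i j 1 k \<odot> Z\<^sub>u k j)"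
proof
  fix e :: "nat \<Rightarrow> complex"
  obtain M where M: "\<And>m. m \<ge> M \<Longrightarrow> mode (W (\<beta> 1)) u (int m) (chain_after 1 v e) = 0"
    "\<And>k j m y. k \<in> {2..n} \<Longrightarrow> m \<ge> M \<Longrightarrow> Z\<^sub>u k j (e(1 := e 1 + of_nat m + 1 + of_nat i, k := y)) = 0"
    using first_mode_bounds by metis
  obtain R where R: "finite R"
    "\<And>k j l s. k \<in> {1..n} \<Longrightarrow> j < J \<Longrightarrow> l \<le> 2 * N - 2 \<Longrightarrow> s \<notin> R \<Longrightarrow> fls_nth (f l) (s + int i) *
       Z\<^sub>u k j ((e(1 := e 1 - of_int s))(k := (e(1 := e 1 - of_int s)) k - of_nat l + of_nat j)) = 0"
    using kernel_exponent_range by metis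
  \<comment> \<open>\<open>P\<close> and \<open>Q\<close> are the polar and the \<open>f\<^sub>l\<close>-contributions, stripped of the factors that do not
    depend on \<open>k\<close> and \<open>j\<close>. For \<open>k = 1\<close> the two updates in \<open>Q\<close> hit the same variable, as \<open>e\<^sub>i\<^bsup>j\<^esup>\<close> requires.\<close>
  define P where "P m k j = (of_nat m gchoose j)
      * Z\<^sub>u k j (e(1 := e 1 + of_nat m + 1 + of_nat i, k := e k - of_nat m + of_nat j))" for m k j
  define Q where "Q k j l s = (of_nat l gchoose j)
      * Z\<^sub>u k j ((e(1 := e 1 - of_int s))(k := (e(1 := e 1 - of_int s)) k - of_nat l + of_nat j))" for k j l s
  define c where "c l s = ((of_int s + of_nat i) gchoose i) * fls_nth (f l) (s + int i)" for l s
  have one: "(e_series N f i j 1 \<odot> Z\<^sub>u 1 j) e = (\<Sum>l=0..2*N-2. \<Sum>s\<in>R. c l s * Q 1 j l s)" if "j < J" for j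
  proof -
    have "(e_series N f i j 1 \<odot> Z\<^sub>u 1 j) e = (\<Sum>l=0..2*N-2. \<Sum>s\<in>R.
      ((of_int s + of_nat i) gchoose i) * fls_nth (f l) (s + int i) * (of_nat l gchoose j)
       * Z\<^sub>u 1 j (e(1 := e 1 - of_int s - of_nat l + of_nat j)))"
      by (rule e_series_product_coeff[OF R(1)])
        (use R(2)[of 1 j] n_pos that in \<open>simp only: fun_upd_upd fun_upd_same, simp\<close>)
    then show ?thesis
      by (simp only: c_def Q_def fun_upd_upd fun_upd_same mult.assoc)
  qed
  have later: "(pi_deriv N f i j 1 k \<odot> Z\<^sub>u k j) e =
      (\<Sum>m<M. ((- of_nat m - 1) gchoose i) * P m k j) + (\<Sum>l=0..2*N-2. \<Sum>s\<in>R. c l s * Q k j l s)"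
    if k: "k \<in> {2..n}" and j: "j < J" for k j
  proof -
    have "k \<noteq> 1" and k1: "k \<in> {1..n}" using k by auto
    have "(pi_deriv N f i j 1 k \<odot> Z\<^sub>u k j) e =
      (\<Sum>m<M. ((- of_nat m - 1) gchoose i) * (of_nat m gchoose j)
        * Z\<^sub>u k j (e(1 := e 1 + of_nat m + 1 + of_nat i, k := e k - of_nat m + of_nat j))) +
      (\<Sum>l=0..2*N-2. \<Sum>s\<in>R. ((of_int s + of_nat i) gchoose i) * fls_nth (f l) (s + int i) * (of_nat l gchoose j)
          * Z\<^sub>u k j (e(1 := e 1 - of_int s, k := e k - of_nat l + of_nat j)))"
    proof (rule pi_deriv_product_coeff)
      show "1 \<noteq> k" "finite R" using \<open>k \<noteq> 1\<close> R(1) by auto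
      show "Z\<^sub>u k j (e(1 := e 1 + of_nat m + 1 + of_nat i, k := e k - of_nat m + of_nat j)) = 0"
        if "m \<ge> M" for m
        by (rule M(2)[OF k that])
      show "fls_nth (f l) (s + int i) * Z\<^sub>u k j (e(1 := e 1 - of_int s, k := e k - of_nat l + of_nat j)) = 0"
        if "l \<le> 2 * N - 2" "s \<notin> R" for l s
        using R(2)[OF k1 j that] by (simp only: fun_upd_other[OF \<open>k \<noteq> 1\<close>])
    qed
    then show ?thesis
      by (simp only: c_def P_def Q_def fun_upd_other[OF \<open>k \<noteq> 1\<close>] mult.assoc)
  qed
  have "((\<Sum>j<J. e_series N f i j 1 \<odot> Z\<^sub>u 1 j) + (\<Sum>k=2..n. \<Sum>j<J. pi_deriv N f i j 1 k \<odot> Z\<^sub>u k j)) e =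
      (\<Sum>j<J. \<Sum>l=0..2*N-2. \<Sum>s\<in>R. c l s * Q 1 j l s) +
      (\<Sum>k=2..n. \<Sum>j<J. (\<Sum>m<M. ((- of_nat m - 1) gchoose i) * P m k j) +
        (\<Sum>l=0..2*N-2. \<Sum>s\<in>R. c l s * Q k j l s))"
    unfolding plus_fun_apply sum_fun_apply
    by (intro sum.cong refl arg_cong2[where f = "(+)"] one later) auto
  also have "\<dots> = (\<Sum>k=2..n. \<Sum>j<J. \<Sum>m<M. ((- of_nat m - 1) gchoose i) * P m k j) +
      (\<Sum>k=1..n. \<Sum>j<J. \<Sum>l=0..2*N-2. \<Sum>s\<in>R. c l s * Q k j l s)"
  proof -
    have "(\<Sum>k=1..n. g k) = g 1 + (\<Sum>k=2..n. g k)" for g :: "nat \<Rightarrow> complex"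
      using sum.atLeast_Suc_atMost[OF n_pos, of g] by (simp add: numeral_2_eq_2)
    then show ?thesis
      by (simp only: sum.distrib add.assoc add.left_commute)
  qed
  also have "(\<Sum>k=1..n. \<Sum>j<J. \<Sum>l=0..2*N-2. \<Sum>s\<in>R. c l s * Q k j l s) =
      (\<Sum>l=0..2*N-2. \<Sum>s\<in>R. c l s * (\<Sum>k=1..n. \<Sum>j<J. Q k j l s))"
    unfolding sum_swap4[where A = "{0..2*N-2}"] sum_distrib_left ..
  also have "\<dots> = 0"
  proof -
    have "(\<Sum>k=1..n. \<Sum>j<J. Q k j l s) = 0" if "l \<in> {0..2*N-2}" for l s
      unfolding Q_def by (rule ward_identity[OF _ assms]) (use that in simp)
    then show ?thesis by simp
  qed
  also have "(\<Sum>k=2..n. \<Sum>j<J. \<Sum>m<M. ((- of_nat m - 1) gchoose i) * P m k j) =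
      (\<Sum>m<M. ((- of_nat m - 1) gchoose i) * (\<Sum>k=2..n. \<Sum>j<J. P m k j))"
    unfolding sum_swap3[where A = "{..<M}"] sum_distrib_left ..
  also have "\<dots> = Z0 V B \<Y> n \<alpha> \<beta> (v(1 := mode (W (\<alpha> 1)) u (- int i - 1) (v 1))) e"
    using first_negative_mode[OF assms M(1), where i = i] by (simp only: P_def)
  finally show "Z0 V B \<Y> n \<alpha> \<beta> (v(1 := mode (W (\<alpha> 1)) u (- int i - 1) (v 1))) e =
    ((\<Sum>j<J. e_series N f i j 1 \<odot> Z\<^sub>u 1 j) + (\<Sum>k=2..n. \<Sum>j<J. pi_deriv N f i j 1 k \<odot> Z\<^sub>u k j)) e"
    by simp
qed

end

theorem proposition5p1:
  fixes V :: "'a::complex_vector voa"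
    and B :: "'a \<Rightarrow> 'a \<Rightarrow> complex"
    and W :: "'i \<Rightarrow> 'a vmodule"
    and h :: "'i \<Rightarrow> complex"
    and o\<^sub>V :: 'i
    and dual :: "'i \<Rightarrow> 'i"
    and \<Y> :: "'i \<Rightarrow> 'i \<Rightarrow> 'i \<Rightarrow> 'a \<Rightarrow> complex \<Rightarrow> 'a \<Rightarrow> 'a"
    and N n :: nat
    and u :: 'a
    and \<alpha> \<beta> :: "nat \<Rightarrow> 'i"
    and v :: "nat \<Rightarrow> 'a"
    and f :: "nat \<Rightarrow> complex fls"
  assumes "is_voa V" and "simple_voa V" and "strong_CFT_type V"
    and "contragredient V (adjoint V) (adjoint V)"
    and "invariant_form V B" and "nondegenerate_form V B" and "B (vac V) (vac V) = 1"
    and "irreducible_family V W h" and "W o\<^sub>V = adjoint V"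
    and "\<And>\<alpha>. contragredient V (W \<alpha>) (W (dual \<alpha>))"
    and "\<And>\<alpha> \<beta> \<gamma>. intertwining_op V (W \<alpha>) (W \<beta>) (W \<gamma>) (\<Y> \<alpha> \<beta> \<gamma>)"
    and "\<And>\<beta> u r w. u \<in> carr V \<Longrightarrow> w \<in> carr (W \<beta>) \<Longrightarrow>
           \<Y> o\<^sub>V \<beta> \<beta> u r w = complex_modes (W \<beta>) u r w"
    and "\<And>\<alpha> \<gamma>. has_fusion_number V (W \<alpha>) (W o\<^sub>V) (W \<gamma>) (if \<alpha> = \<gamma> then 1 else 0)"
    and "\<And>\<alpha> \<beta>. has_fusion_number V (W \<alpha>) (W \<beta>) (W o\<^sub>V) (if \<alpha> = dual \<beta> then 1 else 0)"
    and "n \<ge> 1"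
    and "\<beta> 0 = o\<^sub>V" and "\<beta> n = o\<^sub>V" and "\<beta> 1 = dual (\<alpha> 1)" and "\<beta> (n - 1) = \<alpha> n"
    and "\<And>k. k \<in> {1..n} \<Longrightarrow> v k \<in> carr (W (\<alpha> k))"
    and "N \<ge> 1" and "quasiprimary V N u"
  shows
    "(\<forall>p::complex poly. degree p \<le> 2 * N - 2 \<longrightarrow>
        (\<Sum>k=1..n. Sum_any (\<lambda>j::nat.
           Z0 V B \<Y> n \<alpha> \<beta> (v(k := mode (W (\<alpha> k)) u (int j) (v k)))
             \<odot> divided_deriv k j (poly_in_var k p))) = 0) \<and>
     Z0_insert V B \<Y> n \<alpha> \<beta> u v =
        (\<Sum>k=1..n. Sum_any (\<lambda>j::nat.
           pi_deriv N f 0 j 0 k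
             \<odot> Z0 V B \<Y> n \<alpha> \<beta> (v(k := mode (W (\<alpha> k)) u (int j) (v k))))) \<and>
     (\<forall>i::nat.
        Z0 V B \<Y> n \<alpha> \<beta> (v(1 := mode (W (\<alpha> 1)) u (- int i - 1) (v 1))) =
        Sum_any (\<lambda>j::nat.
           e_series N f i j 1
             \<odot> Z0 V B \<Y> n \<alpha> \<beta> (v(1 := mode (W (\<alpha> 1)) u (int j) (v 1)))) +
        (\<Sum>k=2..n. Sum_any (\<lambda>j::nat.
           pi_deriv N f i j 1 k
             \<odot> Z0 V B \<Y> n \<alpha> \<beta> (v(k := mode (W (\<alpha> k)) u (int j) (v k))))))"
proof -
  interpret chain: intertwiner_chain V B W h o\<^sub>V \<Y> n \<alpha> \<beta>
    by unfold_locales (use assms in auto)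
  have adm: "chain.admissible v"
    using assms(20) by (simp add: chain.admissible_def)
  have "u \<in> carr V"
    using assms(22) by (simp add: quasiprimary_def wt_space_def)
  then have "\<exists>J. \<forall>j\<ge>J. mode (W (\<alpha> k)) u (int j) (v k) = 0" if "k \<in> {1..n}" for k
    using truncated_mode[OF chain.weak _ assms(20)[OF that]] by metis
  then obtain K where K: "\<And>k j. k \<in> {1..n} \<Longrightarrow> j \<ge> K k \<Longrightarrow> mode (W (\<alpha> k)) u (int j) (v k) = 0"
    by metis
  define J where "J = Max (K ` {1..n})"
  interpret ward: genus_zero_ward V B W h o\<^sub>V \<Y> n \<alpha> \<beta> u N v J
  proof
    fix k j assume k: "k \<in> {1..n}" and "J \<le> j"
    then have "K k \<le> j"
      using Max_ge[of "K ` {1..n}" "K k"] by (simp add: J_def)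
    then show "mode (W (\<alpha> k)) u (int j) (v k) = 0"
      by (rule K[OF k])
  qed (use assms adm in auto)
  have Z: "Z0 V B \<Y> n \<alpha> \<beta> (v(k := mode (W (\<alpha> k)) u (int j) (v k))) = ward.Z\<^sub>u k j" for k j
    by (simp add: ward.Z\<^sub>u_def ward.v\<^sub>u_def)
  have left: "Sum_any (\<lambda>j. ward.Z\<^sub>u k j \<odot> F j) = (\<Sum>j<J. ward.Z\<^sub>u k j \<odot> F j)"
    and right: "Sum_any (\<lambda>j. F j \<odot> ward.Z\<^sub>u k j) = (\<Sum>j<J. F j \<odot> ward.Z\<^sub>u k j)"
    if "k \<in> {1..n}" for k F
    by (rule Sum_any_eq_sum_reindex[where \<phi> = "\<lambda>j. j"];
        use that in \<open>simp add: ward.Z\<^sub>u_zero fs_mult_zero_left fs_mult_zero_right\<close>)+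
  have "1 \<in> {1..n}" using assms(15) by simp
  show ?thesis
  proof (intro conjI allI impI)
    fix p :: "complex poly" assume deg: "degree p \<le> 2 * N - 2"
    show "(\<Sum>k=1..n. Sum_any (\<lambda>j::nat.
           Z0 V B \<Y> n \<alpha> \<beta> (v(k := mode (W (\<alpha> k)) u (int j) (v k)))
             \<odot> divided_deriv k j (poly_in_var k p))) = 0"
      unfolding Z ward.ward_polynomial[OF deg assms(21), symmetric] by (intro sum.cong refl left)
  next
    show "Z0_insert V B \<Y> n \<alpha> \<beta> u v =
        (\<Sum>k=1..n. Sum_any (\<lambda>j::nat.
           pi_deriv N f 0 j 0 k
             \<odot> Z0 V B \<Y> n \<alpha> \<beta> (v(k := mode (W (\<alpha> k)) u (int j) (v k)))))"
      unfolding Z ward.insertion_expansion[OF assms(21), where f = f] by (intro sum.cong refl right[symmetric])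
  next
    fix i :: nat
    have "(\<Sum>k=2..n. Sum_any (\<lambda>j. pi_deriv N f i j 1 k \<odot> ward.Z\<^sub>u k j)) =
        (\<Sum>k=2..n. \<Sum>j<J. pi_deriv N f i j 1 k \<odot> ward.Z\<^sub>u k j)"
      by (intro sum.cong refl right) auto
    then show "Z0 V B \<Y> n \<alpha> \<beta> (v(1 := mode (W (\<alpha> 1)) u (- int i - 1) (v 1))) =
        Sum_any (\<lambda>j::nat.
           e_series N f i j 1
             \<odot> Z0 V B \<Y> n \<alpha> \<beta> (v(1 := mode (W (\<alpha> 1)) u (int j) (v 1)))) +
        (\<Sum>k=2..n. Sum_any (\<lambda>j::nat.
           pi_deriv N f i j 1 k
             \<odot> Z0 V B \<Y> n \<alpha> \<beta> (v(k := mode (W (\<alpha> k)) u (int j) (v k)))))"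
      unfolding Z ward.first_mode_expansion[OF assms(21), where f = f] by (simp only: right[OF \<open>1 \<in> {1..n}\<close>])
  qed
qed

end
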